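(* Let $s\in\mathbb{C}$ and let $F:(\mathbb{R}\setminus\mathbb{Z})\times(\mathbb{R}\setminus\mathbb{Z})\to\mathbb{C}$ be continuous and satisfy: (1) $F(a+1,c)=F(a,c)$ and $F(a,c+1)=e^{-2\pi i a}F(a,c)$ for all $(a,c)\in(\mathbb{R}\setminus\mathbb{Z})\times(\mathbb{R}\setminus\mathbb{Z})$; (2) at least one of the following holds: (2-a) $\Re(s)>0$, and for each $0<c<1$ the function $f_c(a):=F(a,c)$ lies in $L^1[(0,1),da]$, and all Fourier coefficients $f_n(c)=\int_0^1F(a,c)e^{-2\pi i n a}\,da$, $n\in\mathbb{Z}$, are continuous functions of $c$; (2-c) $\Re(s)<1$, and for each $0<a<1$ the function $g_a(c):=e^{2\pi i a c}F(a,c)$ lies in $L^1[(0,1),dc]$, and all Fourier coefficients $g_n(a)=\int_0^1e^{2\pi i a c}F(a,c)e^{-2\pi i n c}\,dc$, $n\in\mathbb{Z}$, are continuous functions of $a$; (3) for every $m\ge1$, $\frac1m\sum_{k=0}^{m-1}F\big(\frac{a+k}{m},mc\big)=m^{-s}F(a,c)$ for all $(a,c)\in(\mathbb{R}\setminus\mathbb{Z})\times(\mathbb{R}\setminus\frac1m\mathbb{Z})$. Then $F$ is the restriction to noninteger $(a,c)$ of a function in $\mathcal{E}_s$.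
   Context: $\mathcal{E}_s$ is the complex vector space of functions on $(\mathbb{R}\setminus\mathbb{Z})\times(\mathbb{R}\setminus\mathbb{Z})$ spanned by $L^{+}(s,a,c)$, $L^{-}(s,a,c)$, $e^{-2\pi i a c}L^{+}(1-s,1-c,a)$, $e^{-2\pi i a c}L^{-}(1-s,1-c,a)$, where for real $a,c\notin\mathbb{Z}$ and $\Re(s)>0$, $L^{+}(s,a,c)=\sum_{n\in\mathbb{Z}}e^{2\pi i n a}|n+c|^{-s}$ and $L^{-}(s,a,c)=\sum_{n\in\mathbb{Z}}\operatorname{sgn}(n+c)e^{2\pi i n a}|n+c|^{-s}$ (limits of symmetric partial sums), continued analytically in $s$ to entire functions, which is used for all $s\in\mathbb{C}$. *)

theory Defs
  imports "HOL-Complex_Analysis.Complex_Analysis" "HOL-Library.Function_Algebras"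
begin

text \<open>
  The general term of the two Lerch series, with the sign factor
  (\<open>1\<close> or \<open>sgn (n + c)\<close>) as the parameter \<open>w\<close>.
\<close>

definition lerch_term :: "(real \<Rightarrow> real) \<Rightarrow> complex \<Rightarrow> real \<Rightarrow> real \<Rightarrow> int \<Rightarrow> complex" where
  "lerch_term w s a c n =
     complex_of_real (w (of_int n + c)) * cis (2 * pi * of_int n * a)
       * complex_of_real \<bar>of_int n + c\<bar> powr (- s)"

text \<open>
  For non-integer \<open>a\<close> and \<open>c\<close>, \<open>lerch_fun w s a c\<close> is the value at \<open>s\<close> of the entire function
  that agrees with the limit of the symmetric partial sums on the half-plane \<open>Re z > 0\<close>; it is
  unique by the identity theorem. For integer \<open>a\<close> or \<open>c\<close> the value is never used.
\<close>

definition lerch_fun :: "(real \<Rightarrow> real) \<Rightarrow> complex \<Rightarrow> real \<Rightarrow> real \<Rightarrow> complex" where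
  "lerch_fun w s a c =
     (THE f. f holomorphic_on UNIV \<and>
        (\<forall>z. Re z > 0 \<longrightarrow>
           (\<lambda>N. \<Sum>n\<in>{- int N..int N}. lerch_term w z a c n) \<longlonglongrightarrow> f z)) s"

definition Lplus :: "complex \<Rightarrow> real \<Rightarrow> real \<Rightarrow> complex" where
  "Lplus = lerch_fun (\<lambda>_. 1)"

definition Lminus :: "complex \<Rightarrow> real \<Rightarrow> real \<Rightarrow> complex" where
  "Lminus = lerch_fun sgn"

text \<open>
  The complex span of the four generators under pointwise operations. The functions are total on
  \<open>real \<times> real\<close>, but only their restrictions to non-integer \<open>(a, c)\<close> are meaningful.
\<close>

definition lerch_space :: "complex \<Rightarrow> (real \<times> real \<Rightarrow> complex) set" where
  "lerch_space s =
     module.span (\<lambda>(k::complex) G p. k * G p)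
       {\<lambda>(a, c). Lplus s a c,
        \<lambda>(a, c). Lminus s a c,
        \<lambda>(a, c). cis (- 2 * pi * a * c) * Lplus (1 - s) (1 - c) a,
        \<lambda>(a, c). cis (- 2 * pi * a * c) * Lminus (1 - s) (1 - c) a}"

end

theory Submission
  imports Defs
begin

text \<open>
  Suppose \<open>Re s > 0\<close> and Fourier-expand \<open>F\<close> in the variable \<open>a\<close>. Twisted periodicity says that the
  \<open>n\<close>-th coefficient at \<open>c\<close> is \<open>h (c + n)\<close> for one function \<open>h\<close> on the non-integers, and comparing
  mean values in the Hecke relation gives \<open>h (m * x) = m powr (- s) * h x\<close>. Hence
  \<open>h (r * x) = r powr (- s) * h x\<close> for irrational \<open>x\<close> and positive rational \<open>r\<close>, and continuity makes
  \<open>h x\<close> a multiple of \<open>\<bar>x\<bar> powr (- s)\<close> on each half-line. The Fourier series of \<open>F\<close> is therefore a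
  combination of the two Lerch series. It converges, so by Fejer's theorem it converges to \<open>F\<close>.

  The case \<open>Re s < 1\<close> with expansion in \<open>c\<close> is the same statement for \<open>1 - s\<close> and the function
  \<open>cis (- 2 * pi * a * c) * F (c, - a)\<close>, which satisfies the same hypotheses.
\<close>

section \<open>Analytic continuation of the Lerch series\<close>

text \<open>
  \<open>K\<close> summations by parts replace the terms \<open>(x + n) powr (- z)\<close> by their \<open>K\<close>-th differences, whose
  series converges for \<open>Re z > 1 - K\<close>.
\<close>

primrec powr_diff :: "nat \<Rightarrow> complex \<Rightarrow> real \<Rightarrow> complex" where
  "powr_diff 0 z t = of_real t powr (- z)"
| "powr_diff (Suc K) z t = powr_diff K z (t + 1) - powr_diff K z t"

section \<open>Size of the iterated differences of a complex power\<close>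

lemma powr_diff_has_vector_derivative:
  assumes "t > 0"
  shows "(powr_diff K z has_vector_derivative - z * powr_diff K (z + 1) t) (at t)"
  using assms
proof (induction K arbitrary: t)
  case 0
  have "((\<lambda>w. w powr (- z)) has_field_derivative - z * complex_of_real t powr - (z + 1)) (at (of_real t))"
    using has_field_derivative_powr[of "complex_of_real t" "- z"] 0
    by (simp add: complex_nonpos_Reals_iff minus_diff_commute)
  from has_vector_derivative_real_field[OF this, of UNIV] show ?case by (simp add: o_def)
next
  case (Suc K)
  have "((\<lambda>t. powr_diff K z (t + 1)) has_vector_derivative - z * powr_diff K (z + 1) (t + 1)) (at t)"
  proof -
    have "((\<lambda>t. t + 1) has_vector_derivative 1) (at t)"
      by (auto simp flip: has_real_derivative_iff_has_vector_derivative intro!: derivative_eq_intros)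
    from vector_diff_chain_at[OF this Suc.IH[of "t + 1"]] Suc.prems show ?thesis
      by (simp add: o_def)
  qed
  from has_vector_derivative_diff[OF this Suc.IH[OF Suc.prems]]
  show ?case by (simp add: algebra_simps)
qed

text \<open>A difference over \<open>[t, t + 1]\<close> is bounded by the supremum of the
  derivative, and differentiating in \<open>t\<close> costs a factor \<open>z\<close> and shifts
  \<open>z\<close> to \<open>z + 1\<close>. Each difference therefore gains one power of
  \<open>t\<close>, and the factors \<open>z\<close>, \<open>z + 1\<close>, ... accumulate to the
  Pochhammer symbol. The sign condition makes the power non-increasing, so its supremum is attained
  at \<open>t\<close>.\<close>

lemma norm_powr_diff_le:
  assumes "t > 0" "Re z + real K \<ge> 0"
  shows "norm (powr_diff K z t) \<le> norm (pochhammer z K) * t powr - (Re z + real K)"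
  using assms
proof (induction K arbitrary: z t)
  case 0
  then show ?case by (simp add: norm_powr_real_powr)
next
  case (Suc K)
  let ?B = "norm (pochhammer z (Suc K)) * t powr - (Re z + real (Suc K))"
  have "norm (powr_diff K z (t + 1) - powr_diff K z t) \<le> ?B * norm (t + 1 - t)"
  proof (rule differentiable_bound[where S = "{t..t+1}"])
    fix x assume x: "x \<in> {t..t+1}"
    show "(powr_diff K z has_derivative (\<lambda>h. h *\<^sub>R (- z * powr_diff K (z + 1) x))) (at x within {t..t+1})"
      using powr_diff_has_vector_derivative[of x K z] x Suc.prems
      by (auto simp: has_vector_derivative_def intro: has_derivative_at_withinI)
    have "norm (z * powr_diff K (z + 1) x) \<le> norm z * (norm (pochhammer (z + 1) K) * x powr - (Re (z + 1) + real K))"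
      using x Suc.prems unfolding norm_mult by (intro mult_left_mono Suc.IH) auto
    also have "x powr - (Re (z + 1) + real K) \<le> t powr - (Re (z + 1) + real K)"
      using x Suc.prems by (intro powr_mono2') auto
    also have "norm z * (norm (pochhammer (z + 1) K) * t powr - (Re (z + 1) + real K)) = ?B"
      by (simp add: pochhammer_rec norm_mult algebra_simps)
    finally have "norm (z * powr_diff K (z + 1) x) \<le> ?B" by (simp add: mult_left_mono)
    then show "onorm (\<lambda>h. h *\<^sub>R (- z * powr_diff K (z + 1) x)) \<le> ?B"
      by (intro onorm_le) (subst mult.commute[of ?B], auto intro!: mult_left_mono)
  qed auto
  then show ?case by simp
qed

lemma holomorphic_powr_diff: "t > 0 \<Longrightarrow> (\<lambda>z. powr_diff K z t) holomorphic_on S"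
  by (induction K arbitrary: t) (auto intro!: holomorphic_intros)

lemma powr_diff_tendsto_0:
  assumes "x > 0" "Re z + real K > 0" "norm u = 1"
  shows "(\<lambda>N. u ^ N * powr_diff K z (x + real N)) \<longlonglongrightarrow> 0"
proof (rule Lim_null_comparison)
  show "\<forall>\<^sub>F N in sequentially. norm (u ^ N * powr_diff K z (x + real N))
          \<le> norm (pochhammer z K) * (x + real N) powr - (Re z + real K)"
    using assms norm_powr_diff_le[of "x + real _" z K]
    by (intro always_eventually) (auto simp: norm_mult norm_power)
  have "filterlim (\<lambda>N. x + real N) at_top sequentially"
    by (intro filterlim_tendsto_add_at_top[OF tendsto_const] filterlim_real_sequentially)
  then have "(\<lambda>N. (x + real N) powr - (Re z + real K)) \<longlonglongrightarrow> 0"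
    using assms by (intro tendsto_neg_powr) auto
  then show "(\<lambda>N. norm (pochhammer z K) * (x + real N) powr - (Re z + real K)) \<longlonglongrightarrow> 0"
    by (rule tendsto_mult_right_zero)
qed

section \<open>Holomorphy of the differenced series\<close>

definition powr_diff_series :: "complex \<Rightarrow> real \<Rightarrow> nat \<Rightarrow> complex \<Rightarrow> complex" where
  "powr_diff_series u x K z = (\<Sum>n. u ^ n * powr_diff K z (x + real n))"

lemma
  assumes "x > 0" "norm u = 1"
  shows summable_powr_diff:
      "Re z + real K > 1 \<Longrightarrow> summable (\<lambda>n. u ^ n * powr_diff K z (x + real n))"
    and holomorphic_powr_diff_series: "powr_diff_series u x K holomorphic_on {z. Re z + real K > 1}"
proof -
  let ?S = "{z. Re z + real K > 1}"
  let ?f = "\<lambda>n z. u ^ n * powr_diff K z (x + real n)"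
  have "?S = {z. Re z > 1 - real K}" by auto
  then have op: "open ?S" by (simp add: open_halfspace_Re_gt)
  obtain g where g: "\<forall>z\<in>?S. (\<lambda>n. ?f n z) sums g z \<and> g field_differentiable (at z)"
  proof (rule series_differentiable_comparison_complex[OF op])
    fix n and z assume "z \<in> ?S"
    have "(\<lambda>z. ?f n z) holomorphic_on UNIV"
      using assms by (intro holomorphic_intros holomorphic_powr_diff) auto
    then show "?f n field_differentiable (at z)"
      by (simp add: holomorphic_on_def)
  next
    fix z assume z: "z \<in> ?S"
    \<comment> \<open>On the closed ball of radius \<open>d\<close> the exponent
      \<open>Re y + real K\<close> stays at least \<open>p = 1 + d\<close>, half way between its
      value at \<open>z\<close> and the critical value \<open>1\<close>. Compactness bounds the
      Pochhammer factor there, so a multiple of \<open>n powr - p\<close> dominates the terms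
      uniformly.\<close>
    define d where "d = (Re z + real K - 1) / 2"
    define p where "p = 1 + d"
    have d: "d > 0" "p > 1" using z by (auto simp: d_def p_def)
    have Re_y: "Re y + real K \<ge> p" if "y \<in> cball z d" for y
    proof -
      have "\<bar>Re (z - y)\<bar> \<le> d"
        using that abs_Re_le_cmod[of "z - y"] by (simp add: dist_norm)
      then have "Re y \<ge> Re z - d" by simp
      then show ?thesis unfolding p_def d_def by (simp add: field_simps)
    qed
    have "compact ((\<lambda>y. pochhammer y K) ` cball z d)"
      unfolding pochhammer_prod by (intro compact_continuous_image continuous_intros) auto
    then have "bounded ((\<lambda>y. pochhammer y K) ` cball z d)"
      by (rule compact_imp_bounded)
    then obtain P where "\<forall>y\<in>cball z d. norm (pochhammer y K) \<le> P"
      unfolding bounded_iff by auto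
    then have P: "norm (pochhammer y K) \<le> P" if "y \<in> cball z d" for y
      using that by blast
    have P0: "P \<ge> 0" using P[of z] d by (auto intro: order_trans[OF norm_ge_zero])
    \<comment> \<open>The term \<open>n = 0\<close> is left out because \<open>0 powr - p\<close> is
      \<open>0\<close>; domination is only required eventually.\<close>
    have bound: "norm (?f n y) \<le> P * real n powr - p" if "y \<in> cball z d" "n > 0" for n y
    proof -
      have "norm (?f n y) \<le> norm (pochhammer y K) * (x + real n) powr - (Re y + real K)"
        using norm_powr_diff_le[of "x + real n" y K] assms Re_y[OF that(1)] d
        by (auto simp: norm_mult norm_power)
      also have "\<dots> \<le> P * real n powr - p"
      proof (intro mult_mono P P0 that)
        have "(x + real n) powr - (Re y + real K) \<le> (x + real n) powr - p"
          using Re_y[OF that(1)] assms that(2) by (intro powr_mono) auto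
        also have "\<dots> \<le> real n powr - p"
          using assms that(2) d by (intro powr_mono2') auto
        finally show "(x + real n) powr - (Re y + real K) \<le> real n powr - p" .
      qed auto
      finally show ?thesis .
    qed
    show "\<exists>d h. 0 < d \<and> summable h \<and> range h \<subseteq> \<real>\<^sub>\<ge>\<^sub>0 \<and>
        (\<forall>\<^sub>F n in sequentially. \<forall>y\<in>ball z d \<inter> ?S. cmod (?f n y) \<le> cmod (h n))"
    proof (intro exI conjI)
      have "summable (\<lambda>n. P * real n powr - p)"
        using d by (intro summable_mult) (simp add: summable_real_powr_iff)
      then show "summable (\<lambda>n. complex_of_real (P * real n powr - p))"
        by (rule summable_of_real)
      show "range (\<lambda>n. complex_of_real (P * real n powr - p)) \<subseteq> \<real>\<^sub>\<ge>\<^sub>0"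
        using P0 by (auto simp: nonneg_Reals_of_real_iff)
      show "\<forall>\<^sub>F n in sequentially. \<forall>y\<in>ball z d \<inter> ?S. cmod (?f n y) \<le> cmod (complex_of_real (P * real n powr - p))"
        using eventually_gt_at_top[of 0]
      proof eventually_elim
        case (elim n)
        then show ?case using bound P0 by (auto simp: norm_mult)
      qed
    qed (use d in auto)
  qed
  have g_eq: "g z = powr_diff_series u x K z" if "z \<in> ?S" for z
    using g that by (auto simp: powr_diff_series_def sums_unique)
  show "summable (\<lambda>n. ?f n z)" if "Re z + real K > 1"
    using g that by (auto intro: sums_summable)
  have "g holomorphic_on ?S"
    using g by (auto simp: holomorphic_on_def intro: field_differentiable_at_within)
  then show "powr_diff_series u x K holomorphic_on ?S"
    by (rule holomorphic_transform) (rule g_eq)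
qed

section \<open>Gluing the continuations of the one-sided series\<close>

text \<open>Abel summation against the geometric partial sums of \<open>u ^ n\<close>: the sum of
  the \<open>K\<close>-th differences is traded for that of the faster decaying next differences, at
  the price of boundary terms.\<close>

lemma powr_diff_sum_by_parts:
  assumes "u \<noteq> 1"
  shows "(\<Sum>n<N. u ^ n * powr_diff K z (x + real n)) =
           (powr_diff K z x - u ^ N * powr_diff K z (x + real N)) / (1 - u)
           + u / (1 - u) * (\<Sum>n<N. u ^ n * powr_diff (Suc K) z (x + real n))"
proof (induction N)
  case (Suc N)
  have "(p - v * b) / (1 - u) + u / (1 - u) * S + v * b =
      (p - u * v * b') / (1 - u) + u / (1 - u) * (S + v * (b' - b))" for p v b b' S :: complex
    using assms by (simp add: divide_simps) (simp add: algebra_simps)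
  moreover have "x + real (Suc N) = x + real N + 1" by simp
  ultimately show ?case
    unfolding sum.lessThan_Suc Suc by (simp only: powr_diff.simps power_Suc)
qed simp

text \<open>What \<open>K\<close> summations by parts leave in the limit: the boundary terms at
  \<open>x\<close>, and the differenced series as remainder. The remainder converges for
  \<open>Re z + real K > 1\<close>, so growing \<open>K\<close> reaches every
  \<open>z\<close>.\<close>

definition lerch_cont :: "complex \<Rightarrow> real \<Rightarrow> nat \<Rightarrow> complex \<Rightarrow> complex" where
  "lerch_cont u x K z = (\<Sum>k<K. (u / (1 - u)) ^ k * (powr_diff k z x / (1 - u)))
     + (u / (1 - u)) ^ K * powr_diff_series u x K z"

text \<open>One more summation by parts, passed to the limit; its boundary term at infinity
  vanishes. Neighbouring continuations thus agree on the smaller of their half-planes.\<close>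

lemma lerch_cont_Suc:
  assumes "x > 0" "norm u = 1" "u \<noteq> 1" "Re z + real K > 1"
  shows "lerch_cont u x (Suc K) z = lerch_cont u x K z"
proof -
  have "(\<lambda>N. (powr_diff K z x - u ^ N * powr_diff K z (x + real N)) / (1 - u)
           + u / (1 - u) * (\<Sum>n<N. u ^ n * powr_diff (Suc K) z (x + real n)))
     \<longlonglongrightarrow> (powr_diff K z x - 0) / (1 - u) + u / (1 - u) * powr_diff_series u x (Suc K) z"
    unfolding powr_diff_series_def
    using assms by (intro tendsto_intros powr_diff_tendsto_0 summable_LIMSEQ summable_powr_diff) auto
  moreover have "(\<lambda>N. \<Sum>n<N. u ^ n * powr_diff K z (x + real n)) \<longlonglongrightarrow> powr_diff_series u x K z"
    unfolding powr_diff_series_def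
    using assms by (intro summable_LIMSEQ summable_powr_diff) auto
  ultimately have "powr_diff_series u x K z = powr_diff K z x / (1 - u) + u / (1 - u) * powr_diff_series u x (Suc K) z"
    unfolding powr_diff_sum_by_parts[OF assms(3), of K z x] using LIMSEQ_unique by fastforce
  then show ?thesis
    by (simp add: lerch_cont_def algebra_simps)
qed

text \<open>The original series may converge only conditionally for \<open>Re z > 0\<close>. A
  single summation by parts makes it absolutely convergent on this whole half-plane, hence the index
  \<open>1\<close>.\<close>

lemma lerch_series_tendsto:
  assumes "x > 0" "norm u = 1" "u \<noteq> 1" "Re z > 0"
  shows "(\<lambda>N. \<Sum>n<N. u ^ n * of_real (x + real n) powr (- z)) \<longlonglongrightarrow> lerch_cont u x 1 z"
proof -
  have "(\<lambda>N. (powr_diff 0 z x - u ^ N * powr_diff 0 z (x + real N)) / (1 - u)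
           + u / (1 - u) * (\<Sum>n<N. u ^ n * powr_diff (Suc 0) z (x + real n)))
     \<longlonglongrightarrow> (powr_diff 0 z x - 0) / (1 - u) + u / (1 - u) * powr_diff_series u x (Suc 0) z"
    unfolding powr_diff_series_def
    using assms by (intro tendsto_intros powr_diff_tendsto_0 summable_LIMSEQ summable_powr_diff) auto
  then show ?thesis
    unfolding powr_diff_sum_by_parts[OF assms(3), of 0 z x, symmetric]
    by (simp add: lerch_cont_def)
qed

lemma one_sided_lerch_entire:
  assumes x: "x > 0" and u: "norm u = 1" "u \<noteq> 1"
  obtains f where "f holomorphic_on UNIV"
    "\<And>z. Re z > 0 \<Longrightarrow> (\<lambda>N. \<Sum>n<N. u ^ n * of_real (x + real n) powr (- z)) \<longlonglongrightarrow> f z"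
proof -
  \<comment> \<open>The \<open>K\<close> picked at \<open>z\<close> makes
    \<open>Re z + real K\<close> at least \<open>2\<close>, safely above \<open>1\<close>. Any other
    admissible \<open>K\<close> gives the same value, so near each point \<open>f\<close> coincides
    with one \<open>lerch_cont\<close> of fixed \<open>K\<close>, which is holomorphic
    there.\<close>
  define f where "f z = lerch_cont u x (nat \<lceil>2 - Re z\<rceil>) z" for z
  have f_eq: "f z = lerch_cont u x K z" if "Re z + real K > 1" for z K
  proof -
    have mono: "lerch_cont u x (m + j) z = lerch_cont u x m z" if "Re z + real m > 1" for m j
      using that by (induction j) (use lerch_cont_Suc[OF x u] in auto)
    define L where "L = nat \<lceil>2 - Re z\<rceil>"
    have "Re z + real L > 1" unfolding L_def by linarith
    with that mono[of L "K - L"] mono[of K "L - K"] show ?thesis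
      unfolding f_def L_def[symmetric] by (cases "K \<le> L") auto
  qed
  have hol: "lerch_cont u x K holomorphic_on {z. Re z + real K > 1}" for K
    unfolding lerch_cont_def using u x
    by (intro holomorphic_intros holomorphic_powr_diff holomorphic_powr_diff_series) auto
  show ?thesis
  proof
    have "f analytic_on {z}" for z
    proof -
      obtain K :: nat where K: "1 - Re z < real K" using reals_Archimedean2 by blast
      have op: "open {z. Re z + real K > 1}"
        using open_halfspace_Re_gt[of "1 - real K"] by (simp add: algebra_simps)
      have "f holomorphic_on {z. Re z + real K > 1}"
        using hol[of K] by (rule holomorphic_transform) (simp add: f_eq)
      with op have "f analytic_on {z. Re z + real K > 1}"
        by (simp add: analytic_on_open)
      then show ?thesis
        by (rule analytic_on_subset) (use K in auto)
    qed
    then show "f holomorphic_on UNIV"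
      by (metis analytic_imp_holomorphic analytic_on_analytic_at)
  next
    fix z :: complex assume "Re z > 0"
    then show "(\<lambda>N. \<Sum>n<N. u ^ n * of_real (x + real n) powr (- z)) \<longlonglongrightarrow> f z"
      using lerch_series_tendsto[OF x u] f_eq[of z 1] by simp
  qed
qed

section \<open>The two-sided series\<close>

text \<open>With \<open>k\<close> the floor of a non-integer \<open>c\<close>, cutting at
  \<open>- k\<close> separates the positive from the negative \<open>n + c\<close>. The bound on
  \<open>k\<close> keeps both lengths nonnegative, so that \<open>nat\<close> truncates
  nothing.\<close>

lemma sum_symmetric_int_split:
  fixes T :: "int \<Rightarrow> complex"
  assumes "\<bar>k\<bar> \<le> int N"
  shows "(\<Sum>n\<in>{- int N..int N}. T n) =
     (\<Sum>j<nat (int N + k + 1). T (int j - k)) + (\<Sum>j<nat (int N - k). T (- k - 1 - int j))"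
proof -
  have "{- int N..int N} = {-k..int N} \<union> {- int N..- k - 1}" using assms by auto
  then have "(\<Sum>n\<in>{- int N..int N}. T n) = (\<Sum>n\<in>{-k..int N}. T n) + (\<Sum>n\<in>{- int N..- k - 1}. T n)"
    by (simp add: sum.union_disjoint)
  also have "(\<Sum>n\<in>{-k..int N}. T n) = (\<Sum>j<nat (int N + k + 1). T (int j - k))"
    by (rule sum.reindex_bij_witness[of _ "\<lambda>j. int j - k" "\<lambda>n. nat (n + k)"]) auto
  also have "(\<Sum>n\<in>{- int N..- k - 1}. T n) = (\<Sum>j<nat (int N - k). T (- k - 1 - int j))"
    by (rule sum.reindex_bij_witness[of _ "\<lambda>j. - k - 1 - int j" "\<lambda>n. nat (- k - 1 - n)"]) auto
  finally show ?thesis .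
qed

lemma cis_2pi_eq_1_iff: "cis (2 * pi * a) = 1 \<longleftrightarrow> a \<in> \<int>"
proof
  assume "cis (2 * pi * a) = 1"
  then have "cos (2 * pi * a) = 1" by (metis Re_complex_of_real cis.sel(1) of_real_1)
  then show "a \<in> \<int>" unfolding cos_one_2pi_int by (auto simp: Ints_def mult.commute[of pi] )
qed (auto simp: Ints_def)

text \<open>With \<open>x = frac c\<close>, the absolute value of \<open>n + c\<close> runs through
  \<open>x + j\<close> on the positive side and \<open>1 - x + j\<close> on the negative side, and
  \<open>w\<close> is constant on each. The two-sided series is therefore a combination of two
  one-sided series with ratios \<open>u\<close> and \<open>cnj u\<close>.\<close>

lemma lerch_entire_exists:
  assumes a: "a \<notin> \<int>" and c: "c \<notin> \<int>"
    and w: "\<And>y. y > 0 \<Longrightarrow> w y = wp" "\<And>y. y < 0 \<Longrightarrow> w y = wm"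
  obtains f where "f holomorphic_on UNIV"
    "\<And>z. Re z > 0 \<Longrightarrow> (\<lambda>N. \<Sum>n\<in>{- int N..int N}. lerch_term w z a c n) \<longlonglongrightarrow> f z"
proof -
  define k where "k = \<lfloor>c\<rfloor>"
  define x where "x = frac c"
  have x: "x > 0" "1 - x > 0" and cx: "c = of_int k + x"
    using c frac_lt_1[of c] frac_gt_0_iff[of c] unfolding x_def k_def by (auto simp: frac_def)
  define u where "u = cis (2 * pi * a)"
  have u: "norm u = 1" "u \<noteq> 1" "norm (cnj u) = 1" "cnj u \<noteq> 1"
    using cis_2pi_eq_1_iff[of a] a by (auto simp: u_def)
  obtain f where f: "f holomorphic_on UNIV"
    "\<And>z. Re z > 0 \<Longrightarrow> (\<lambda>N. \<Sum>n<N. u ^ n * of_real (x + real n) powr (- z)) \<longlonglongrightarrow> f z"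
    using one_sided_lerch_entire x u by blast
  obtain g where g: "g holomorphic_on UNIV"
    "\<And>z. Re z > 0 \<Longrightarrow> (\<lambda>N. \<Sum>n<N. (cnj u) ^ n * of_real (1 - x + real n) powr (- z)) \<longlonglongrightarrow> g z"
    using one_sided_lerch_entire x u by blast
  \<comment> \<open>\<open>A\<close> and \<open>B\<close> carry the weight and the phase of the
    innermost terms, \<open>n = - k\<close> and \<open>n = - k - 1\<close>.\<close>
  define A where "A = of_real wp * cis (- 2 * pi * of_int k * a)"
  define B where "B = of_real wm * cis (2 * pi * (- of_int k - 1) * a)"
  have pos: "lerch_term w z a c (int j - k) = A * (u ^ j * of_real (x + real j) powr (- z))" for z j
  proof -
    have e: "of_int (int j - k) + c = x + real j" by (simp add: cx)
    have "cis (2 * pi * of_int (int j - k) * a) = cis (- 2 * pi * of_int k * a) * u ^ j"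
      unfolding u_def Complex.DeMoivre cis_mult by (rule arg_cong[where f = cis]) (simp add: algebra_simps)
    moreover have "w (x + real j) = wp" using x by (intro w) auto
    moreover have "\<bar>x + real j\<bar> = x + real j" using x by auto
    ultimately show ?thesis unfolding lerch_term_def e A_def by (simp only: mult_ac)
  qed
  have neg: "lerch_term w z a c (- k - 1 - int j) = B * (cnj u ^ j * of_real (1 - x + real j) powr (- z))" for z j
  proof -
    have e: "of_int (- k - 1 - int j) + c = - (1 - x + real j)" by (simp add: cx)
    have "w (- (1 - x + real j)) = wm" using x by (intro w) auto
    moreover have "\<bar>- (1 - x + real j)\<bar> = 1 - x + real j" using x by auto
    moreover have "cis (2 * pi * of_int (- k - 1 - int j) * a) = cis (2 * pi * (- of_int k - 1) * a) * cnj u ^ j"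
      unfolding u_def cis_cnj Complex.DeMoivre cis_mult by (rule arg_cong[where f = cis]) (simp add: algebra_simps)
    ultimately show ?thesis unfolding lerch_term_def e B_def by (simp only: mult_ac)
  qed
  show ?thesis
  proof
    show "(\<lambda>z. A * f z + B * g z) holomorphic_on UNIV"
      using f g by (intro holomorphic_intros) auto
  next
    fix z :: complex assume z: "Re z > 0"
    have l1: "filterlim (\<lambda>N. nat (int N + k + 1)) at_top sequentially"
      unfolding filterlim_at_top
    proof
      fix Z show "\<forall>\<^sub>F N in sequentially. Z \<le> nat (int N + k + 1)"
        using eventually_ge_at_top[of "Z + nat \<bar>k\<bar>"] by eventually_elim linarith
    qed
    have l2: "filterlim (\<lambda>N. nat (int N - k)) at_top sequentially"
      unfolding filterlim_at_top
    proof
      fix Z show "\<forall>\<^sub>F N in sequentially. Z \<le> nat (int N - k)"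
        using eventually_ge_at_top[of "Z + nat \<bar>k\<bar>"] by eventually_elim linarith
    qed
    have "(\<lambda>N. A * (\<Sum>j<nat (int N + k + 1). u ^ j * of_real (x + real j) powr (- z))
           + B * (\<Sum>j<nat (int N - k). cnj u ^ j * of_real (1 - x + real j) powr (- z)))
           \<longlonglongrightarrow> A * f z + B * g z"
      using filterlim_compose[OF f(2)[OF z] l1] filterlim_compose[OF g(2)[OF z] l2]
      by (intro tendsto_intros) auto
    moreover have "\<forall>\<^sub>F N in sequentially. A * (\<Sum>j<nat (int N + k + 1). u ^ j * of_real (x + real j) powr (- z))
           + B * (\<Sum>j<nat (int N - k). cnj u ^ j * of_real (1 - x + real j) powr (- z))
           = (\<Sum>n\<in>{- int N..int N}. lerch_term w z a c n)"
      using eventually_ge_at_top[of "nat \<bar>k\<bar>"]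
    proof eventually_elim
      case (elim N)
      then show ?case
        by (subst sum_symmetric_int_split[of k]) (auto simp: pos neg sum_distrib_left)
    qed
    ultimately show "(\<lambda>N. \<Sum>n\<in>{- int N..int N}. lerch_term w z a c n) \<longlonglongrightarrow> A * f z + B * g z"
      by (rule Lim_transform_eventually)
  qed
qed

text \<open>An entire function is determined by its values on \<open>Re z > 0\<close>, by the
  identity theorem. The definite description in \<open>lerch_fun\<close> therefore picks out the
  function supplied by \<open>lerch_entire_exists\<close>.\<close>

lemma lerch_fun_tendsto:
  assumes a: "a \<notin> \<int>" and c: "c \<notin> \<int>"
    and w: "\<And>y. y > 0 \<Longrightarrow> w y = wp" "\<And>y. y < 0 \<Longrightarrow> w y = wm"
    and s: "Re s > 0"
  shows "(\<lambda>N. \<Sum>n\<in>{- int N..int N}. lerch_term w s a c n) \<longlonglongrightarrow> lerch_fun w s a c"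
proof -
  let ?P = "\<lambda>f. f holomorphic_on UNIV \<and>
    (\<forall>z. Re z > 0 \<longrightarrow> (\<lambda>N. \<Sum>n\<in>{- int N..int N}. lerch_term w z a c n) \<longlonglongrightarrow> f z)"
  obtain f where f: "?P f"
    by (rule lerch_entire_exists[OF a c w]) blast+
  have f_unique: "g = f" if g: "?P g" for g
  proof
    fix z
    show "g z = f z"
    proof (rule analytic_continuation_open[of "{z. Re z > 0}" UNIV g f])
      show "g z = f z" if "z \<in> {z. Re z > 0}" for z
        using that f g LIMSEQ_unique by blast
      show "{z. Re z > 0} \<noteq> {}" by (auto intro: exI[of _ 1])
    qed (use f g in \<open>auto simp: open_halfspace_Re_gt\<close>)
  qed
  from f f_unique have "(THE f. ?P f) = f" by (rule the_equality)
  with f s show ?thesis unfolding lerch_fun_def by simp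
qed

section \<open>Fejer's theorem\<close>

definition unit_lborel :: "real measure" where
  "unit_lborel = restrict_space lborel {0<..<1}"

lemma set_integrable_unit_iff:
  fixes f :: "real \<Rightarrow> 'a::{banach, second_countable_topology}"
  shows "set_integrable lborel {0<..<1} f \<longleftrightarrow> integrable unit_lborel f"
  unfolding unit_lborel_def set_integrable_def by (subst integrable_restrict_space) auto

lemma set_integral_unit_eq:
  fixes f :: "real \<Rightarrow> 'a::{banach, second_countable_topology}"
  shows "(LBINT t:{0<..<1}. f t) = (\<integral>t. f t \<partial>unit_lborel)"
  unfolding unit_lborel_def set_lebesgue_integral_def by (subst integral_restrict_space) auto

lemma space_unit_lborel [simp]: "space unit_lborel = {0<..<1}"
  by (simp add: unit_lborel_def space_restrict_space)

lemma emeasure_unit_lborel: "emeasure unit_lborel {0<..<1} = 1"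
  unfolding unit_lborel_def by (subst emeasure_restrict_space) auto

lemma measure_unit_lborel [simp]: "measure unit_lborel {0<..<1} = 1"
  by (simp add: measure_def emeasure_unit_lborel)

lemma integrable_const_unit [simp]:
  fixes c :: "'a::{banach, second_countable_topology}"
  shows "integrable unit_lborel (\<lambda>t. c)"
  using finite_measure.integrable_const[of unit_lborel c]
  by (simp add: finite_measureI emeasure_unit_lborel)

lemma integrable_unit_mult_bounded:
  fixes g h :: "real \<Rightarrow> complex"
  assumes g: "integrable unit_lborel g"
    and h: "continuous_on {0<..<1} h" "\<And>t. t \<in> {0<..<1} \<Longrightarrow> norm (h t) \<le> B"
  shows "integrable unit_lborel (\<lambda>t. g t * h t)"
proof (rule Bochner_Integration.integrable_bound)
  show "integrable unit_lborel (\<lambda>t. g t * of_real B)" using g by simp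
  have "h \<in> borel_measurable unit_lborel"
    using borel_measurable_continuous_on_restrict[OF h(1)]
    by (simp add: unit_lborel_def cong: measurable_cong_sets sets_restrict_space_cong)
  then show "(\<lambda>t. g t * h t) \<in> borel_measurable unit_lborel"
    using g by (intro borel_measurable_times) auto
  have "norm (g t * h t) \<le> norm (g t * of_real B)" if "t \<in> {0<..<1}" for t
    using h(2)[OF that] by (auto simp: norm_mult intro!: mult_left_mono)
  then show "AE t in unit_lborel. norm (g t * h t) \<le> norm (g t * of_real B)"
    by (intro AE_I2) auto
qed

lemma integral_unit_cis:
  "(\<integral>t. cis (2 * pi * of_int n * t) \<partial>unit_lborel) = (if n = 0 then 1 else 0)"
proof (cases "n = 0")
  case False
  define k where "k = 2 * pi * of_int n"
  have k: "k \<noteq> 0" using False by (simp add: k_def)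
  have d: "((\<lambda>t. cis (k * t) / (\<i> * of_real k)) has_vector_derivative cis (k * t)) (at t within {0..1})" for t
  proof -
    have "((\<lambda>w. exp (\<i> * of_real k * w) / (\<i> * of_real k)) has_field_derivative exp (\<i> * of_real k * of_real t)) (at (of_real t))"
      using k by (auto intro!: derivative_eq_intros)
    from has_vector_derivative_real_field[OF this, of "{0..1}"] show ?thesis
      by (simp add: cis_conv_exp o_def mult_ac)
  qed
  have "(LBINT t:{0<..<1}. cis (k * t)) = (LBINT t:{0..1}. cis (k * t))"
    by (rule set_integral_discrete_difference[where X = "{0,1}"]) auto
  also have "\<dots> = cis (k * 1) / (\<i> * of_real k) - cis (k * 0) / (\<i> * of_real k)"
    unfolding set_lebesgue_integral_def
    by (rule integral_FTC_Icc[OF _ d]) (auto intro!: continuous_intros)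
  also have "cis (k * 1) = 1" by (simp add: k_def)
  finally show ?thesis using False by (simp add: set_integral_unit_eq k_def)
qed simp

section \<open>Dirichlet sums and the Fejer kernel\<close>

definition dirichlet_sum :: "nat \<Rightarrow> real \<Rightarrow> complex" where
  "dirichlet_sum N x = (\<Sum>k<N. cis (2 * pi * real k * x))"

text \<open>This is \<open>N\<close> times the Fejer kernel: the squared norm shows its positivity,
  the double sum its Fourier coefficients.\<close>

lemma dirichlet_sum_norm_square:
  "of_real ((norm (dirichlet_sum N x))\<^sup>2) =
     (\<Sum>j<N. \<Sum>k<N. cis (2 * pi * of_int (int j - int k) * x))"
  unfolding complex_norm_square dirichlet_sum_def cnj_sum sum_product cis_cnj cis_mult
  by (intro sum.cong refl arg_cong[where f = cis]) (simp add: algebra_simps)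

text \<open>The geometric sum telescopes. The bound does not depend on \<open>N\<close>, and the
  product form stays valid at integer \<open>x\<close>, where the second factor vanishes.\<close>

lemma norm_dirichlet_sum_le: "norm (dirichlet_sum N x) * norm (1 - cis (2 * pi * x)) \<le> 2"
proof -
  have "dirichlet_sum N x = (\<Sum>k<N. cis (2 * pi * x) ^ k)"
    unfolding dirichlet_sum_def Complex.DeMoivre
    by (intro sum.cong refl arg_cong[where f = cis]) (simp add: algebra_simps)
  then have "dirichlet_sum N x * (1 - cis (2 * pi * x)) = 1 - cis (2 * pi * x) ^ N"
    by (simp add: one_diff_power_eq mult.commute)
  then have "norm (dirichlet_sum N x) * norm (1 - cis (2 * pi * x)) = norm (1 - cis (2 * pi * x) ^ N)"
    by (metis norm_mult)
  also have "\<dots> \<le> norm (1::complex) + norm (cis (2 * pi * x) ^ N)" by (rule norm_triangle_ineq4)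
  finally show ?thesis by (simp add: norm_power)
qed

lemma norm_dirichlet_sum_le_of_nat: "norm (dirichlet_sum N x) \<le> real N"
  unfolding dirichlet_sum_def by (rule order_trans[OF norm_sum]) simp

lemma continuous_on_dirichlet_sum [continuous_intros]:
  "continuous_on A f \<Longrightarrow> continuous_on A (\<lambda>t. dirichlet_sum N (f t))"
  unfolding dirichlet_sum_def by (intro continuous_intros)

text \<open>The left side is \<open>N\<close> times the Fejer mean of the Fourier series at
  \<open>a\<close>; moving the exponentials under the integral gathers them into the kernel at
  \<open>a - t\<close>.\<close>

lemma fejer_sum_eq_integral:
  assumes g: "integrable unit_lborel g"
  shows "(\<Sum>j<N. \<Sum>k<N. (\<integral>t. g t * cis (- 2 * pi * of_int (int j - int k) * t) \<partial>unit_lborel)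
             * cis (2 * pi * of_int (int j - int k) * a))
         = (\<integral>t. g t * of_real ((norm (dirichlet_sum N (a - t)))\<^sup>2) \<partial>unit_lborel)"
proof -
  have i: "integrable unit_lborel (\<lambda>t. g t * cis (2 * pi * of_int n * (a - t)))" for n :: int
    by (intro integrable_unit_mult_bounded[OF g, where B = 1] continuous_intros) auto
  have "(\<integral>t. g t * cis (- 2 * pi * of_int n * t) \<partial>unit_lborel) * cis (2 * pi * of_int n * a)
      = (\<integral>t. g t * cis (2 * pi * of_int n * (a - t)) \<partial>unit_lborel)" for n
    unfolding integral_mult_left_zero[symmetric]
    by (intro Bochner_Integration.integral_cong refl) (simp add: cis_mult mult.assoc algebra_simps)
  then show ?thesis
    unfolding dirichlet_sum_norm_square sum_distrib_left
    by (simp add: i del: of_int_diff of_int_of_nat_eq mult_minus_left)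
qed

lemma integral_fejer_kernel:
  "(\<integral>t. (norm (dirichlet_sum N (a - t)))\<^sup>2 \<partial>unit_lborel) = real N"
proof -
  have "complex_of_real (\<integral>t. (norm (dirichlet_sum N (a - t)))\<^sup>2 \<partial>unit_lborel)
      = (\<integral>t. 1 * of_real ((norm (dirichlet_sum N (a - t)))\<^sup>2) \<partial>unit_lborel)"
    by (simp del: of_real_power)
  also have "\<dots> = (\<Sum>j<N. \<Sum>k<N. (\<integral>t. 1 * cis (- 2 * pi * of_int (int j - int k) * t) \<partial>unit_lborel)
             * cis (2 * pi * of_int (int j - int k) * a))"
    by (rule fejer_sum_eq_integral[symmetric]) simp
  \<comment> \<open>Orthogonality of the exponentials leaves only the diagonal.\<close>
  also have "\<dots> = (\<Sum>j<N. \<Sum>k<N. if k = j then 1 else 0)"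
  proof (intro sum.cong refl)
    fix j k
    show "(\<integral>t. 1 * cis (- 2 * pi * of_int (int j - int k) * t) \<partial>unit_lborel) * cis (2 * pi * of_int (int j - int k) * a)
          = (if k = j then 1 else (0::complex))"
      using integral_unit_cis[of "int k - int j"] by (auto simp: algebra_simps)
  qed
  also have "\<dots> = of_real (real N)" by simp
  finally show ?thesis unfolding of_real_eq_iff .
qed

text \<open>The kernel is an approximate identity: nonnegative, of mass \<open>N\<close> before
  normalisation, and bounded independently of \<open>N\<close> away from \<open>a\<close>. Near
  \<open>a\<close> the continuity of \<open>g\<close> controls the error; elsewhere integrability
  bounds it by a constant, which disappears on division by \<open>N\<close>.\<close>

theorem fejer_pointwise:
  assumes g: "integrable unit_lborel g" and a: "a \<in> {0<..<1}" and cont: "isCont g a"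
  shows "(\<lambda>N. (\<Sum>j<N. \<Sum>k<N. (\<integral>t. g t * cis (- 2 * pi * of_int (int j - int k) * t) \<partial>unit_lborel)
             * cis (2 * pi * of_int (int j - int k) * a)) / of_nat N) \<longlonglongrightarrow> g a"
proof (rule LIMSEQ_I)
  fix \<epsilon> :: real assume \<epsilon>: "\<epsilon> > 0"
  let ?D = "\<lambda>N t. (norm (dirichlet_sum N (a - t)))\<^sup>2"
  obtain \<delta> where \<delta>: "\<delta> > 0" "\<And>t. dist t a < \<delta> \<Longrightarrow> dist (g t) (g a) < \<epsilon> / 2"
    using cont \<epsilon> unfolding continuous_at_eps_delta by (metis half_gt_zero)
  define T where "T = {t\<in>{0..1}. \<delta> \<le> dist t a}"
  have "T = {0..1} \<inter> {t. \<delta> \<le> dist t a}" by (auto simp: T_def)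
  moreover have "closed {t. \<delta> \<le> dist t a}"
    by (intro closed_Collect_le continuous_intros)
  ultimately have "compact T" by (simp add: compact_Int_closed)
  \<comment> \<open>The expression vanishes only if \<open>a - t\<close> is an integer. As
    \<open>a\<close> is interior to the unit interval, this forces \<open>t = a\<close>, a point
    outside \<open>T\<close>; compactness then gives a positive lower bound.\<close>
  obtain \<eta> where \<eta>: "\<eta> > 0" "\<And>t. t \<in> T \<Longrightarrow> norm (1 - cis (2 * pi * (a - t))) \<ge> \<eta>"
  proof (cases "T = {}")
    case False
    have "continuous_on T (\<lambda>t. norm (1 - cis (2 * pi * (a - t))))"
      by (intro continuous_intros)
    from continuous_attains_inf[OF \<open>compact T\<close> False this] obtain t0 where t0: "t0 \<in> T"
      "\<And>t. t \<in> T \<Longrightarrow> norm (1 - cis (2 * pi * (a - t0))) \<le> norm (1 - cis (2 * pi * (a - t)))" by blast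
    have "a - t0 \<notin> \<int>"
    proof
      assume "a - t0 \<in> \<int>"
      then obtain m :: int where m: "a - t0 = of_int m" by (auto elim: Ints_cases)
      with t0 a have "\<bar>real_of_int m\<bar> < 1" by (auto simp: T_def)
      then have "m = 0" by linarith
      with m t0 \<delta> show False by (auto simp: T_def)
    qed
    then have "norm (1 - cis (2 * pi * (a - t0))) > 0"
      using cis_2pi_eq_1_iff[of "a - t0"] by auto
    then show ?thesis using that t0 by blast
  qed (use that[of 1] in auto)
  \<comment> \<open>\<open>C\<close> bounds the part of the error away from \<open>a\<close>: on
    \<open>T\<close> the Dirichlet sum is at most \<open>2 / \<eta>\<close>, so its squared norm is
    at most \<open>4 / \<eta>\<^sup>2\<close>.\<close>
  define C where "C = 4 / \<eta>\<^sup>2 * (\<integral>t. norm (g t - g a) \<partial>unit_lborel)"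
  have int1: "integrable unit_lborel (\<lambda>t. g t - g a)" using g by simp
  have bd: "norm (complex_of_real (?D N t)) \<le> (real N)\<^sup>2" for N t
    using norm_dirichlet_sum_le_of_nat by (simp add: norm_power power_mono)
  have intD: "integrable unit_lborel (\<lambda>t. ?D N t)" for N
  proof -
    have "integrable unit_lborel (\<lambda>t. 1 * complex_of_real (?D N t))"
      by (intro integrable_unit_mult_bounded[where B = "(real N)\<^sup>2"] bd continuous_intros) auto
    then show ?thesis by (simp add: complex_of_real_integrable_eq del: of_real_power)
  qed
  have intgD: "integrable unit_lborel (\<lambda>t. h t * complex_of_real (?D N t))" if "integrable unit_lborel h" for N h
    by (intro integrable_unit_mult_bounded[OF that, where B = "(real N)\<^sup>2"] bd continuous_intros)
  have main: "norm ((\<integral>t. (g t - g a) * complex_of_real (?D N t) \<partial>unit_lborel)) \<le> \<epsilon> / 2 * real N + C" for N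
  proof -
    have "norm ((\<integral>t. (g t - g a) * complex_of_real (?D N t) \<partial>unit_lborel))
        \<le> (\<integral>t. norm ((g t - g a) * complex_of_real (?D N t)) \<partial>unit_lborel)"
      by (rule integral_norm_bound)
    also have "\<dots> \<le> (\<integral>t. \<epsilon> / 2 * ?D N t + 4 / \<eta>\<^sup>2 * norm (g t - g a) \<partial>unit_lborel)"
    proof (rule integral_mono)
      fix t assume t: "t \<in> space unit_lborel"
      show "norm ((g t - g a) * complex_of_real (?D N t)) \<le> \<epsilon> / 2 * ?D N t + 4 / \<eta>\<^sup>2 * norm (g t - g a)"
      proof (cases "dist t a < \<delta>")
        case True
        have "norm ((g t - g a) * complex_of_real (?D N t)) = norm (g t - g a) * ?D N t"
          by (simp add: norm_mult norm_power)
        also have "\<dots> \<le> \<epsilon> / 2 * ?D N t"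
          using \<delta>(2)[OF True] by (intro mult_right_mono) (auto simp: dist_norm)
        also have "\<dots> \<le> \<epsilon> / 2 * ?D N t + 4 / \<eta>\<^sup>2 * norm (g t - g a)" by simp
        finally show ?thesis .
      next
        case False
        then have "t \<in> T" using t by (auto simp: T_def)
        have "norm (dirichlet_sum N (a - t)) * \<eta> \<le> 2"
          using mult_left_mono[OF \<eta>(2)[OF \<open>t \<in> T\<close>], of "norm (dirichlet_sum N (a - t))"]
            norm_dirichlet_sum_le[of N "a - t"] by auto
        then have "norm (dirichlet_sum N (a - t)) \<le> 2 / \<eta>"
          using \<eta>(1) by (simp add: field_simps)
        then have "?D N t \<le> (2 / \<eta>)\<^sup>2" by (intro power_mono) auto
        then have "?D N t \<le> 4 / \<eta>\<^sup>2" by (simp add: power_divide)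
        then have "norm (g t - g a) * ?D N t \<le> norm (g t - g a) * (4 / \<eta>\<^sup>2)"
          by (intro mult_left_mono) auto
        moreover have "\<epsilon> / 2 * ?D N t \<ge> 0" using \<epsilon> by simp
        ultimately show ?thesis by (simp add: norm_mult norm_power mult.commute)
      qed
    qed (use int1 intD intgD in auto)
    also have "\<dots> = \<epsilon> / 2 * real N + C"
      using int1 intD by (simp add: integral_fejer_kernel C_def)
    finally show ?thesis .
  qed
  \<comment> \<open>Beyond \<open>N0\<close> the term \<open>C / N\<close> is below half of
    \<epsilon>; the later \<open>Suc N0\<close> also keeps \<open>N\<close> positive.\<close>
  obtain N0 :: nat where N0: "real N0 > 2 * C / \<epsilon>" using reals_Archimedean2 by blast
  show "\<exists>no. \<forall>N\<ge>no. norm ((\<Sum>j<N. \<Sum>k<N. (\<integral>t. g t * cis (- 2 * pi * of_int (int j - int k) * t) \<partial>unit_lborel)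
             * cis (2 * pi * of_int (int j - int k) * a)) / of_nat N - g a) < \<epsilon>"
  proof (intro exI allI impI)
    fix N assume N: "N \<ge> Suc N0"
    have "(\<integral>t. (g t - g a) * complex_of_real (?D N t) \<partial>unit_lborel)
       = (\<integral>t. g t * complex_of_real (?D N t) \<partial>unit_lborel) - g a * of_nat N"
      using g by (simp add: left_diff_distrib intgD integral_fejer_kernel intD del: of_real_power)
    then have "(\<Sum>j<N. \<Sum>k<N. (\<integral>t. g t * cis (- 2 * pi * of_int (int j - int k) * t) \<partial>unit_lborel)
             * cis (2 * pi * of_int (int j - int k) * a)) / of_nat N - g a
        = (\<integral>t. (g t - g a) * complex_of_real (?D N t) \<partial>unit_lborel) / of_nat N"
      unfolding fejer_sum_eq_integral[OF g] using N by (simp add: diff_divide_distrib)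
    then have "norm ((\<Sum>j<N. \<Sum>k<N. (\<integral>t. g t * cis (- 2 * pi * of_int (int j - int k) * t) \<partial>unit_lborel)
             * cis (2 * pi * of_int (int j - int k) * a)) / of_nat N - g a) \<le> (\<epsilon> / 2 * real N + C) / real N"
      using main[of N] by (simp add: norm_divide divide_right_mono)
    also have "\<dots> < \<epsilon>"
    proof -
      have "real N > 2 * C / \<epsilon>" using N N0 by linarith
      then show ?thesis using N \<epsilon> by (simp add: field_simps)
    qed
    finally show "norm ((\<Sum>j<N. \<Sum>k<N. (\<integral>t. g t * cis (- 2 * pi * of_int (int j - int k) * t) \<partial>unit_lborel)
             * cis (2 * pi * of_int (int j - int k) * a)) / of_nat N - g a) < \<epsilon>" .
  qed
qed

section \<open>Cesaro means and ordinary limits\<close>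

lemma double_sum_diff_eq_sum_symmetric:
  fixes c :: "int \<Rightarrow> complex"
  shows "(\<Sum>j<N. \<Sum>k<N. c (int j - int k)) = (\<Sum>M<N. \<Sum>n\<in>{- int M..int M}. c n)"
proof (induction N)
  case (Suc N)
  \<comment> \<open>Enlarging the square adds one column and one row. The column supplies the
    differences from \<open>- N\<close> to \<open>- 1\<close>, the row those from \<open>0\<close>
    to \<open>N\<close>, each once.\<close>
  have "(\<Sum>n\<in>{- int N..int N}. c n) = (\<Sum>n\<in>{- int N..-1}. c n) + (\<Sum>n\<in>{0..int N}. c n)"
    by (subst sum.union_disjoint[symmetric]) (auto intro!: sum.cong)
  also have "(\<Sum>n\<in>{- int N..-1}. c n) = (\<Sum>j<N. c (int j - int N))"
    by (rule sum.reindex_bij_witness[of _ "\<lambda>j. int j - int N" "\<lambda>n. nat (n + int N)"]) auto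
  also have "(\<Sum>n\<in>{0..int N}. c n) = (\<Sum>k<Suc N. c (int N - int k))"
    by (rule sum.reindex_bij_witness[of _ "\<lambda>k. int N - int k" "\<lambda>n. nat (int N - n)"]) auto
  finally show ?case using Suc by (simp add: sum.distrib)
qed simp

lemma cesaro_limit:
  fixes S :: "nat \<Rightarrow> complex"
  assumes "S \<longlonglongrightarrow> L"
  shows "(\<lambda>N. (\<Sum>M<N. S M) / of_nat N) \<longlonglongrightarrow> L"
proof (rule LIMSEQ_I)
  fix \<epsilon> :: real assume \<epsilon>: "\<epsilon> > 0"
  from LIMSEQ_D[OF assms half_gt_zero[OF this]] obtain N1 where N1: "\<And>M. M \<ge> N1 \<Longrightarrow> norm (S M - L) < \<epsilon> / 2"
    by blast
  define C where "C = (\<Sum>M<N1. norm (S M - L))"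
  have bound: "(\<Sum>M<N. norm (S M - L)) \<le> C + \<epsilon> / 2 * real N" for N
  proof -
    have "(\<Sum>M<N. norm (S M - L)) \<le> (\<Sum>M<N. (if M < N1 then norm (S M - L) else 0) + \<epsilon> / 2)"
      using N1 \<epsilon> by (intro sum_mono) (auto simp: not_less less_imp_le)
    also have "\<dots> = (\<Sum>M<N. if M < N1 then norm (S M - L) else 0) + \<epsilon> / 2 * real N"
      by (simp add: sum.distrib)
    also have "(\<Sum>M<N. if M < N1 then norm (S M - L) else 0) = (\<Sum>M\<in>{..<N} \<inter> {..<N1}. norm (S M - L))"
      by (simp add: sum.inter_restrict lessThan_def)
    also have "\<dots> \<le> C" unfolding C_def by (intro sum_mono2) auto
    finally show ?thesis by simp
  qed
  obtain N0 :: nat where N0: "real N0 > 2 * C / \<epsilon>" using reals_Archimedean2 by blast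
  show "\<exists>no. \<forall>N\<ge>no. norm ((\<Sum>M<N. S M) / of_nat N - L) < \<epsilon>"
  proof (intro exI allI impI)
    fix N assume N: "N \<ge> Suc N0"
    have "(\<Sum>M<N. S M) / of_nat N - L = (\<Sum>M<N. S M - L) / of_nat N"
      using N by (simp add: sum_subtractf diff_divide_distrib)
    then have "norm ((\<Sum>M<N. S M) / of_nat N - L) \<le> (C + \<epsilon> / 2 * real N) / real N"
      using order_trans[OF norm_sum bound[of N]] by (simp add: norm_divide divide_right_mono)
    also have "\<dots> < \<epsilon>"
    proof -
      have "real N > 2 * C / \<epsilon>" using N N0 by linarith
      then show ?thesis using N \<epsilon> by (simp add: field_simps)
    qed
    finally show "norm ((\<Sum>M<N. S M) / of_nat N - L) < \<epsilon>" .
  qed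
qed

text \<open>A convergent sequence has the same limit as its Cesaro means, and Fejer's theorem
  identifies the latter as \<open>g a\<close>. Convergence itself is a hypothesis, to be supplied by
  the Lerch series.\<close>

corollary fourier_series_tendsto_imp_eq:
  assumes g: "integrable unit_lborel g" and a: "a \<in> {0<..<1}" and cont: "isCont g a"
    and lim: "(\<lambda>N. \<Sum>n\<in>{- int N..int N}. (\<integral>t. g t * cis (- 2 * pi * of_int n * t) \<partial>unit_lborel)
             * cis (2 * pi * of_int n * a)) \<longlonglongrightarrow> L"
  shows "g a = L"
  using fejer_pointwise[OF g a cont] cesaro_limit[OF lim]
  unfolding double_sum_diff_eq_sum_symmetric[where c = "\<lambda>n. (\<integral>t. g t * cis (- 2 * pi * of_int n * t) \<partial>unit_lborel)
    * cis (2 * pi * of_int n * a)"]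
  by (rule LIMSEQ_unique)

section \<open>Eigenfunctions with integrable Fourier expansion in the first variable\<close>

lemma open_compl_Ints: "open (- \<int> :: real set)"
  by (simp add: open_Compl)

lemma cis_mult_left: "cis x * (cis y * z) = cis (x + y) * z"
  by (simp add: cis_mult flip: mult.assoc)

lemma twisted_periodic_int:
  fixes F :: "real \<Rightarrow> real \<Rightarrow> complex"
  assumes tw: "\<And>a c. a \<notin> \<int> \<Longrightarrow> c \<notin> \<int> \<Longrightarrow> F a (c + 1) = cis (- 2 * pi * a) * F a c"
    and ac: "a \<notin> \<int>" "c \<notin> \<int>"
  shows "F a (c + of_int n) = cis (- 2 * pi * of_int n * a) * F a c"
proof (induction n rule: int_induct[where k = 0])
  case (step1 i)
  have "F a (c + of_int (i + 1)) = F a ((c + of_int i) + 1)" by (simp add: add_ac)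
  also have "\<dots> = cis (- 2 * pi * a) * F a (c + of_int i)" using ac by (intro tw) auto
  finally have eq: "F a (c + of_int (i + 1)) = cis (- 2 * pi * a) * F a (c + of_int i)" .
  show ?case unfolding eq step1(2) cis_mult_left by (simp add: algebra_simps)
next
  case (step2 i)
  have "F a (c + of_int i) = F a ((c + of_int (i - 1)) + 1)" by (simp add: add_ac)
  also have "\<dots> = cis (- 2 * pi * a) * F a (c + of_int (i - 1))"
    using ac by (intro tw) (auto simp del: of_int_diff)
  finally have eq: "F a (c + of_int (i - 1)) = cis (2 * pi * a) * F a (c + of_int i)"
    by (simp add: cis_mult_left)
  show ?case unfolding eq step2(2) cis_mult_left by (simp add: algebra_simps)
qed simp

section \<open>Functions homogeneous under integer dilations\<close>

text \<open>An irrational base point keeps all its positive rational multiples off the integers. For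
  \<open>r = p / q\<close>, evaluating \<open>h\<close> at \<open>q * (r * x0) = p * x0\<close> in
  two ways gives homogeneity under rational dilations. Continuity extends it to real ratios, so
  \<open>x\<close> itself may be rational.\<close>

lemma homogeneous_off_Ints_powr_scale:
  fixes h :: "real \<Rightarrow> complex"
  assumes cont: "continuous_on (- \<int>) h"
    and mult: "\<And>m x. m \<ge> 1 \<Longrightarrow> real m * x \<notin> \<int> \<Longrightarrow> h (real m * x) = of_nat m powr (- s) * h x"
    and x0: "x0 \<notin> \<rat>"
    and x: "x \<notin> \<int>" "x / x0 > 0"
  shows "h x = of_real (x / x0) powr (- s) * h x0"
proof -
  have x0_nz: "x0 \<noteq> 0" using x0 by auto
  have rat: "h (r * x0) = of_real r powr (- s) * h x0" if r: "r \<in> \<rat>" "r > 0" for r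
  proof -
    from r obtain i j :: int where ij: "r = of_int i / of_int j" "j > 0"
      by (metis Rats_cases' )
    with r have "i > 0" by (simp add: zero_less_divide_iff)
    define p q where "p = nat i" and "q = nat j"
    have pq: "p \<ge> 1" "q \<ge> 1" "r = real p / real q" using ij \<open>i > 0\<close> by (auto simp: p_def q_def)
    have "real p * x0 \<notin> \<int>"
    proof
      assume "real p * x0 \<in> \<int>"
      then have "real p * x0 / real p \<in> \<rat>" using Ints_subset_Rats by (intro Rats_divide) auto
      with x0 pq show False by simp
    qed
    moreover have "real q * (r * x0) = real p * x0" using pq by simp
    ultimately have "of_nat q powr (- s) * h (r * x0) = of_nat p powr (- s) * h x0"
      using mult[of q "r * x0"] mult[of p x0] pq by simp
    moreover have "of_nat p powr (- s) = of_nat q powr (- s) * of_real r powr (- s)"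
    proof -
      have "of_nat p powr (- s) = (of_real (real q) * of_real r) powr (- s)"
        using pq by simp
      also have "\<dots> = of_real (real q) powr (- s) * of_real r powr (- s)"
        using r by (intro powr_times_real) auto
      finally show ?thesis by simp
    qed
    ultimately show ?thesis using pq by simp
  qed
  define y where "y = x / x0"
  have xy: "x = y * x0" "y > 0" using x x0_nz by (auto simp: y_def)
  \<comment> \<open>\<open>d\<close> measures the failure of homogeneity at the ratio
    \<open>t\<close>. It vanishes at positive rationals, hence by continuity at
    \<open>y\<close>.\<close>
  define d where "d t = h (t * x0) - of_real t powr (- s) * h x0" for t
  have "isCont h x"
    using cont x open_compl_Ints by (simp add: continuous_on_eq_continuous_at)
  then have "isCont d y"
    unfolding d_def using xy
    by (intro continuous_intros isCont_o2[of y "\<lambda>t. t * x0" h]) (auto simp: complex_nonpos_Reals_iff)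
  have "d y = 0"
  proof (rule ccontr)
    assume "d y \<noteq> 0"
    with \<open>isCont d y\<close> obtain e where e: "e > 0" "\<And>t. dist y t < e \<Longrightarrow> d t \<noteq> 0"
      using continuous_at_avoid by blast
    obtain r where r: "r \<in> \<rat>" "y < r" "r < y + e"
      using Rats_dense_in_real[of y "y + e"] e by auto
    then show False using e(2)[of r] rat[of r] xy by (auto simp: d_def dist_real_def)
  qed
  then show ?thesis by (simp add: d_def y_def x0_nz)
qed

text \<open>Base points \<open>r\<close> and \<open>- r\<close> serve the two half-lines
  independently. The two resulting constants are written as \<open>A + B\<close> and
  \<open>A - B\<close> to match the weights \<open>1\<close> and \<open>sgn\<close> of the Lerch
  series.\<close>

lemma homogeneous_off_Ints_eq_powr:
  fixes h :: "real \<Rightarrow> complex"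
  assumes cont: "continuous_on (- \<int>) h"
    and mult: "\<And>m x. m \<ge> 1 \<Longrightarrow> real m * x \<notin> \<int> \<Longrightarrow> h (real m * x) = of_nat m powr (- s) * h x"
  obtains A B where
    "\<And>x. x \<notin> \<int> \<Longrightarrow> h x = (A + B * of_real (sgn x)) * of_real \<bar>x\<bar> powr (- s)"
proof -
  have "\<not> {0<..<1::real} \<subseteq> \<rat>"
    using countable_subset[OF _ countable_rat] uncountable_open_interval[of 0 1] by auto
  then obtain r :: real where r: "r > 0" and irr: "r \<notin> \<rat>" "- r \<notin> \<rat>"
    by (auto simp: subset_iff)
  define K where "K = of_real r powr s"
  have scale: "of_real (y / r) powr (- s) = K * of_real y powr (- s)" if "y > 0" for y
  proof -
    have "of_real y powr (- s) = (of_real r * of_real (y / r)) powr (- s)" using r by simp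
    also have "\<dots> = of_real r powr (- s) * of_real (y / r) powr (- s)"
      using that r by (intro powr_times_real) auto
    finally show ?thesis using r that by (simp add: K_def powr_minus)
  qed
  define A where "A = K * (h r + h (- r)) / 2"
  define B where "B = K * (h r - h (- r)) / 2"
  have "h x = (A + B * of_real (sgn x)) * of_real \<bar>x\<bar> powr (- s)" if "x \<notin> \<int>" for x
  proof (cases "x > 0")
    case True
    have "A + B = K * h r" by (simp add: A_def B_def field_simps)
    moreover have "h x = of_real (x / r) powr (- s) * h r"
      using True that r irr by (intro homogeneous_off_Ints_powr_scale[OF cont mult]) auto
    ultimately show ?thesis using True by (simp add: scale mult_ac del: of_real_divide)
  next
    case False
    with that have neg: "x < 0" by (metis Ints_0 linorder_neqE_linordered_idom)
    have "A - B = K * h (- r)" by (simp add: A_def B_def field_simps)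
    moreover have "h x = of_real (x / (- r)) powr (- s) * h (- r)"
      using neg that r irr by (intro homogeneous_off_Ints_powr_scale[OF cont mult]) (auto simp: divide_neg_pos)
    moreover have "x / (- r) = (- x) / r" by simp
    ultimately have "h x = (A - B) * of_real (- x) powr (- s)"
      using neg scale[of "- x"] by (simp only: mult_ac)
    then show ?thesis using neg by simp
  qed
  then show ?thesis by (rule that)
qed

text \<open>The substitution \<open>b = (a + k) / m\<close> carries the unit interval onto the piece
  \<open>J k\<close> with Jacobian \<open>1 / m\<close>, and the \<open>m\<close> pieces tile the
  interval up to the division points.\<close>

lemma integral_unit_distribution:
  fixes g :: "real \<Rightarrow> complex"
  assumes g: "integrable unit_lborel g" and m: "m \<ge> 1"
  shows "(\<Sum>k<m. \<integral>a. g ((a + real k) / real m) \<partial>unit_lborel) = of_nat m * (\<integral>a. g a \<partial>unit_lborel)"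
    and "k < m \<Longrightarrow> integrable unit_lborel (\<lambda>a. g ((a + real k) / real m))"
proof -
  define J where "J k = {real k / real m<..<(real k + 1) / real m}" for k
  define f where "f k b = indicator (J k) b *\<^sub>R g b" for k b
  have J_sub: "J k \<subseteq> {0<..<1}" if "k < m" for k
  proof -
    have "real k + 1 \<le> real m" using that by linarith
    then have "(real k + 1) / real m \<le> 1" using m by simp
    moreover have "real k / real m \<ge> 0" by simp
    ultimately show ?thesis unfolding J_def subset_iff greaterThanLessThan_iff
      by (meson le_less_trans less_le_trans)
  qed
  have f_int: "integrable lborel (f k)" if "k < m" for k
  proof -
    have "set_integrable lborel (J k) g"
      by (rule set_integrable_subset[OF _ _ J_sub[OF that]])
        (use g in \<open>auto simp: set_integrable_unit_iff J_def\<close>)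
    then show ?thesis unfolding set_integrable_def f_def .
  qed
  have f_aff: "f k (real k / real m + 1 / real m * a) = indicator {0<..<1} a *\<^sub>R g ((a + real k) / real m)" for k a
  proof -
    have "real k / real m + 1 / real m * a = (a + real k) / real m"
      by (simp add: add_divide_distrib)
    moreover have "(a + real k) / real m \<in> J k \<longleftrightarrow> a \<in> {0<..<1}"
      using m by (auto simp: J_def divide_less_cancel)
    ultimately show ?thesis by (simp add: f_def indicator_def)
  qed
  show "integrable unit_lborel (\<lambda>a. g ((a + real k) / real m))" if "k < m" for k
    using lborel_integrable_real_affine[OF f_int[OF that], of "1 / real m" "real k / real m"] m
    unfolding f_aff set_integrable_unit_iff[symmetric] set_integrable_def by simp
  have "(\<integral>b. f k b \<partial>lborel) = (1 / real m) *\<^sub>R (\<integral>a. g ((a + real k) / real m) \<partial>unit_lborel)" for k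
    using lborel_integral_real_affine[of "1 / real m" "f k" "real k / real m"] m
    unfolding f_aff by (simp add: set_integral_unit_eq[symmetric] set_lebesgue_integral_def)
  then have "(\<Sum>k<m. \<integral>a. g ((a + real k) / real m) \<partial>unit_lborel) = of_nat m * (\<Sum>k<m. \<integral>b. f k b \<partial>lborel)"
    using m by (simp add: sum_distrib_left scaleR_conv_of_real)
  also have "(\<Sum>k<m. \<integral>b. f k b \<partial>lborel) = (\<integral>b. (\<Sum>k<m. f k b) \<partial>lborel)"
    using f_int by simp
  also have "\<dots> = (\<integral>b. indicator {0<..<1} b *\<^sub>R g b \<partial>lborel)"
  \<comment> \<open>Only finitely many division points are discarded. Any other \<open>b\<close> in
    the unit interval lies in exactly one piece, indexed by the floor of
    \<open>m * b\<close>.\<close>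
  proof (rule integral_discrete_difference[where X = "(\<lambda>k. real k / real m) ` {..m}"])
    fix b assume b: "b \<in> space lborel" "b \<notin> (\<lambda>k. real k / real m) ` {..m}"
    show "(\<Sum>k<m. f k b) = indicator {0<..<1} b *\<^sub>R g b"
    proof (cases "b \<in> {0<..<1}")
      case True
      define j where "j = nat \<lfloor>real m * b\<rfloor>"
      have "0 \<le> real m * b" "real m * b < real m" using True m by auto
      then have j: "j < m" "real j \<le> real m * b" "real m * b < real j + 1"
        unfolding j_def by linarith+
      have "real m * b \<noteq> real j"
      proof
        assume "real m * b = real j"
        then have "b = real j / real m" using m by (simp add: field_simps)
        with b j show False by auto
      qed
      with j have j': "real j < real m * b" by simp
      have "b \<in> J k \<longleftrightarrow> k = j" for k
      proof -
        have "b \<in> J k \<longleftrightarrow> real k < real m * b \<and> real m * b < real k + 1"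
          using m by (auto simp: J_def field_simps)
        then show ?thesis using j' j by auto
      qed
      then have "(\<Sum>k<m. f k b) = (\<Sum>k<m. if k = j then g b else 0)"
        by (intro sum.cong) (auto simp: f_def)
      with True j show ?thesis by simp
    next
      case False
      then have "b \<notin> J k" if "k < m" for k using J_sub[OF that] by blast
      then show ?thesis using False by (simp add: f_def)
    qed
  qed auto
  finally show "(\<Sum>k<m. \<integral>a. g ((a + real k) / real m) \<partial>unit_lborel) = of_nat m * (\<integral>a. g a \<partial>unit_lborel)"
    by (simp add: set_integral_unit_eq[symmetric] set_lebesgue_integral_def)
qed

section \<open>Identifying the Fourier coefficients\<close>

text \<open>Regularity in \<open>a\<close> is used pointwise, for Fejer's theorem, while regularity
  in \<open>c\<close> enters through the Fourier coefficients alone. In this form the result applies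
  both to the given function and to the one with exchanged variables.\<close>

theorem hecke_eigenfunction_fourier_a:
  fixes F :: "real \<Rightarrow> real \<Rightarrow> complex"
  assumes s: "Re s > 0"
    and cont: "\<And>c. c \<notin> \<int> \<Longrightarrow> continuous_on (- \<int>) (\<lambda>a. F a c)"
    and per: "\<And>a c. a \<notin> \<int> \<Longrightarrow> c \<notin> \<int> \<Longrightarrow> F (a + 1) c = F a c"
    and tw: "\<And>a c. a \<notin> \<int> \<Longrightarrow> c \<notin> \<int> \<Longrightarrow> F a (c + 1) = cis (- 2 * pi * a) * F a c"
    and int: "\<And>c. c \<in> {0<..<1} \<Longrightarrow> integrable unit_lborel (\<lambda>a. F a c)"
    and coeff: "\<And>n::int. continuous_on {0<..<1}
           (\<lambda>c. \<integral>a. F a c * cis (- 2 * pi * of_int n * a) \<partial>unit_lborel)"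
    and hecke: "\<And>(m::nat) a c. m \<ge> 1 \<Longrightarrow> a \<notin> \<int> \<Longrightarrow> of_nat m * c \<notin> \<int> \<Longrightarrow>
           1 / of_nat m * (\<Sum>k<m. F ((a + of_nat k) / of_nat m) (of_nat m * c))
             = of_nat m powr (- s) * F a c"
  obtains A B where "\<And>a c. a \<notin> \<int> \<Longrightarrow> c \<notin> \<int> \<Longrightarrow> F a c = A * Lplus s a c + B * Lminus s a c"
proof -
  have unit: "t \<notin> \<int>" if "t \<in> {0<..<1}" for t :: real
    using that by (auto elim!: Ints_cases)
  have tw_int: "F a (c + of_int n) = cis (- 2 * pi * of_int n * a) * F a c"
    if "a \<notin> \<int>" "c \<notin> \<int>" for a c n
    using tw that by (rule twisted_periodic_int[of F])
  have per_int: "F (a + of_int n) c = F a c" if "a \<notin> \<int>" "c \<notin> \<int>" for a c n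
  proof (induction n rule: int_induct[where k = 0])
    case (step1 i)
    then show ?case using per[of "a + of_int i" c] that by (simp add: add_ac)
  next
    case (step2 i)
    then show ?case using per[of "a + of_int (i - 1)" c] that by (simp add: algebra_simps)
  qed simp
  \<comment> \<open>The zeroth coefficient suffices: the twist \<open>cis (- 2 * pi * n * a)\<close>
    produced by shifting \<open>c\<close> by \<open>n\<close> is exactly the character that extracts
    the \<open>n\<close>-th coefficient.\<close>
  define h where "h x = (\<integral>a. F a x \<partial>unit_lborel)" for x
  have coeff_h: "(\<integral>a. F a c * cis (- 2 * pi * of_int n * a) \<partial>unit_lborel) = h (c + of_int n)"
    if c: "c \<notin> \<int>" for c n
    unfolding h_def
  proof (rule Bochner_Integration.integral_cong[OF refl])
    fix a assume "a \<in> space unit_lborel"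
    then show "F a c * cis (- 2 * pi * of_int n * a) = F a (c + of_int n)"
      using tw_int[OF unit c, of a n] by (simp add: mult.commute)
  qed
  have integrable: "integrable unit_lborel (\<lambda>a. F a c)" if c: "c \<notin> \<int>" for c
  proof -
    define x where "x = frac c"
    have x: "x \<in> {0<..<1}" "c = x + of_int \<lfloor>c\<rfloor>"
      using c frac_lt_1[of c] frac_gt_0_iff[of c] unfolding x_def by (auto simp: frac_def)
    have "integrable unit_lborel (\<lambda>a. F a x * cis (- 2 * pi * of_int \<lfloor>c\<rfloor> * a))"
      by (intro integrable_unit_mult_bounded[OF int[OF x(1)], where B = 1] continuous_intros) auto
    moreover have "F a c = F a x * cis (- 2 * pi * of_int \<lfloor>c\<rfloor> * a)" if "a \<in> {0<..<1}" for a
      using tw_int[OF unit[OF that] unit[OF x(1)], of "\<lfloor>c\<rfloor>"] x(2) by (simp add: mult.commute)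
    ultimately show ?thesis by (subst Bochner_Integration.integrable_cong[OF refl]) auto
  qed
  \<comment> \<open>On the interval between consecutive integers around \<open>x\<close>,
    \<open>h\<close> is a translate of the coefficient whose index is the floor of \<open>x\<close>,
    and that coefficient is continuous on the unit interval.\<close>
  have cont_h: "continuous_on (- \<int>) h"
  proof (subst continuous_on_eq_continuous_at[OF open_compl_Ints], intro ballI)
    fix x :: real assume "x \<in> - \<int>"
    then have x: "x \<in> {of_int \<lfloor>x\<rfloor><..<of_int \<lfloor>x\<rfloor> + 1}"
      using frac_lt_1[of x] frac_gt_0_iff[of x] by (auto simp: frac_def)
    let ?I = "{of_int \<lfloor>x\<rfloor><..<of_int \<lfloor>x\<rfloor> + (1::real)}"
    have "continuous_on ?I (\<lambda>y. \<integral>a. F a (y - of_int \<lfloor>x\<rfloor>) * cis (- 2 * pi * of_int \<lfloor>x\<rfloor> * a) \<partial>unit_lborel)"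
      by (rule continuous_on_compose2[OF coeff[of "\<lfloor>x\<rfloor>"], of _ "\<lambda>y. y - of_int \<lfloor>x\<rfloor>"])
        (auto intro!: continuous_intros)
    then have "continuous_on ?I h"
    proof (rule continuous_on_eq)
      fix y assume "y \<in> ?I"
      then have "y - of_int \<lfloor>x\<rfloor> \<notin> \<int>" by (intro unit) auto
      from coeff_h[OF this, of "\<lfloor>x\<rfloor>"]
      show "(\<integral>a. F a (y - of_int \<lfloor>x\<rfloor>) * cis (- 2 * pi * of_int \<lfloor>x\<rfloor> * a) \<partial>unit_lborel) = h y"
        by simp
    qed
    with x show "isCont h x" by (simp add: continuous_on_eq_continuous_at)
  qed
  \<comment> \<open>Integrate the Hecke relation over \<open>a\<close>; the average of the
    \<open>m\<close> integrals is again the mean value, now at \<open>m * x\<close>.\<close>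
  have mult_h: "h (real m * x) = of_nat m powr (- s) * h x" if m: "m \<ge> 1" and x: "real m * x \<notin> \<int>" for m x
  proof -
    note int_m = integral_unit_distribution[OF integrable[OF x] m]
    have "of_nat m powr (- s) * h x = (\<integral>a. of_nat m powr (- s) * F a x \<partial>unit_lborel)"
      by (simp add: h_def)
    also have "\<dots> = (\<integral>a. 1 / of_nat m * (\<Sum>k<m. F ((a + real k) / real m) (real m * x)) \<partial>unit_lborel)"
      using hecke[OF m unit x] by (intro Bochner_Integration.integral_cong) auto
    also have "\<dots> = 1 / of_nat m * (\<Sum>k<m. \<integral>a. F ((a + real k) / real m) (real m * x) \<partial>unit_lborel)"
      using int_m(2) by simp
    also have "\<dots> = h (real m * x)" using m unfolding int_m(1) h_def by simp
    finally show ?thesis by simp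
  qed
  obtain A B where AB: "\<And>x. x \<notin> \<int> \<Longrightarrow> h x = (A + B * of_real (sgn x)) * of_real \<bar>x\<bar> powr (- s)"
    using homogeneous_off_Ints_eq_powr[OF cont_h mult_h] by blast
  show ?thesis
  proof (rule that)
    fix a c :: real assume a: "a \<notin> \<int>" and c: "c \<notin> \<int>"
    \<comment> \<open>Fejer's theorem is applied inside the unit interval. The phases at
      \<open>a0\<close> and \<open>a\<close> agree because the two points differ by an
      integer.\<close>
    define a0 where "a0 = frac a"
    have a0: "a0 \<in> {0<..<1}" "a = a0 + of_int \<lfloor>a\<rfloor>"
      using a frac_lt_1[of a] frac_gt_0_iff[of a] unfolding a0_def by (auto simp: frac_def)
    have cis_a0: "cis (2 * pi * of_int n * a0) = cis (2 * pi * of_int n * a)" for n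
    proof -
      have "cis (2 * pi * of_int n * a) = cis (2 * pi * of_int n * a0 + 2 * pi * of_int (n * \<lfloor>a\<rfloor>))"
        by (subst a0(2)) (simp add: algebra_simps)
      also have "\<dots> = cis (2 * pi * of_int n * a0) * cis (2 * pi * of_int (n * \<lfloor>a\<rfloor>))"
        by (simp only: cis_mult)
      also have "cis (2 * pi * of_int (n * \<lfloor>a\<rfloor>)) = 1"
        by (subst cis_2pi_eq_1_iff) auto
      finally show ?thesis by simp
    qed
    have term_eq: "(\<integral>t. F t c * cis (- 2 * pi * of_int n * t) \<partial>unit_lborel) * cis (2 * pi * of_int n * a0)
        = A * lerch_term (\<lambda>_. 1) s a c n + B * lerch_term sgn s a c n" for n
    proof -
      have "c + of_int n \<notin> \<int>" using c by auto
      from AB[OF this] show ?thesis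
        unfolding coeff_h[OF c] cis_a0 lerch_term_def by (simp add: algebra_simps)
    qed
    have "(\<lambda>N. A * (\<Sum>n\<in>{- int N..int N}. lerch_term (\<lambda>_. 1) s a c n)
           + B * (\<Sum>n\<in>{- int N..int N}. lerch_term sgn s a c n))
          \<longlonglongrightarrow> A * Lplus s a c + B * Lminus s a c"
      unfolding Lplus_def Lminus_def
      by (intro tendsto_intros lerch_fun_tendsto[OF a c _ _ s, where wp = 1 and wm = 1]
          lerch_fun_tendsto[OF a c _ _ s, where wp = 1 and wm = "-1"]) auto
    then have lim: "(\<lambda>N. \<Sum>n\<in>{- int N..int N}. (\<integral>t. F t c * cis (- 2 * pi * of_int n * t) \<partial>unit_lborel)
             * cis (2 * pi * of_int n * a0)) \<longlonglongrightarrow> A * Lplus s a c + B * Lminus s a c"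
      unfolding term_eq by (simp add: sum.distrib sum_distrib_left)
    have "isCont (\<lambda>t. F t c) a0"
      using cont[OF c] unit[OF a0(1)] open_compl_Ints by (simp add: continuous_on_eq_continuous_at)
    from fourier_series_tendsto_imp_eq[OF integrable[OF c] a0(1) this lim]
    have "F a0 c = A * Lplus s a c + B * Lminus s a c" .
    moreover have "F a c = F a0 c"
      using per_int[OF unit[OF a0(1)] c, of "\<lfloor>a\<rfloor>"] a0(2) by simp
    ultimately show "F a c = A * Lplus s a c + B * Lminus s a c" by simp
  qed
qed

section \<open>Exchanging the two variables\<close>

text \<open>Exchanging the variables produces the argument \<open>- a\<close>, which twisted
  periodicity moves to \<open>1 - a\<close>; this brings the integrals back to
  \<open>a\<close>.\<close>

lemma unit_reflect:
  fixes f :: "real \<Rightarrow> complex"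
  shows "integrable unit_lborel (\<lambda>t. f (1 - t)) \<longleftrightarrow> integrable unit_lborel f"
    and "(\<integral>t. f (1 - t) \<partial>unit_lborel) = (\<integral>t. f t \<partial>unit_lborel)"
proof -
  have ind: "indicator {0<..<1} (1 - t) = (indicator {0<..<1} t :: real)" for t :: real
    by (auto simp: indicator_def)
  show "integrable unit_lborel (\<lambda>t. f (1 - t)) \<longleftrightarrow> integrable unit_lborel f"
    using lborel_integrable_real_affine_iff[of "-1" "\<lambda>t. indicator {0<..<1} t *\<^sub>R f t" 1]
    unfolding set_integrable_unit_iff[symmetric] set_integrable_def by (simp add: ind)
  show "(\<integral>t. f (1 - t) \<partial>unit_lborel) = (\<integral>t. f t \<partial>unit_lborel)"
    using lborel_integral_real_affine[of "-1" "\<lambda>t. indicator {0<..<1} t *\<^sub>R f t" 1]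
    unfolding set_integral_unit_eq[symmetric] set_lebesgue_integral_def by (simp add: ind)
qed

lemma sum_roots_of_unity:
  assumes "j < m"
  shows "(\<Sum>k<m. cis (2 * pi * real k * (real j / real m))) = (if j = 0 then of_nat m else 0)"
proof (cases "j = 0")
  case False
  define u where "u = cis (2 * pi * (real j / real m))"
  have "real j / real m \<notin> \<int>"
  proof
    assume "real j / real m \<in> \<int>"
    then obtain i :: int where i: "real j / real m = of_int i" by (auto elim: Ints_cases)
    have "0 < real j / real m" "real j / real m < 1" using False assms by auto
    then show False unfolding i by simp
  qed
  then have "u \<noteq> 1" unfolding u_def cis_2pi_eq_1_iff .
  have "u ^ m = 1"
    using assms cis_2pi_eq_1_iff[of "real j"] by (simp add: u_def Complex.DeMoivre mult_ac)
  then have "(1 - u) * (\<Sum>k<m. u ^ k) = 0" by (simp flip: one_diff_power_eq)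
  with \<open>u \<noteq> 1\<close> have "(\<Sum>k<m. u ^ k) = 0" by simp
  also have "(\<Sum>k<m. u ^ k) = (\<Sum>k<m. cis (2 * pi * real k * (real j / real m)))"
    unfolding u_def Complex.DeMoivre by (simp add: mult_ac)
  finally show ?thesis using False by simp
qed simp

text \<open>Expanding each summand by the given Hecke relation yields a double sum over
  \<open>j\<close> and \<open>k\<close>. The twist contributes a root of unity, and summing over
  \<open>k\<close> annihilates every \<open>j\<close> except \<open>0\<close>. What remains is
  \<open>F' a c\<close>, so the sum is \<open>m powr s\<close> times it and the average has the
  exponent \<open>s - 1\<close>.\<close>

lemma hecke_reflect:
  fixes F :: "real \<Rightarrow> real \<Rightarrow> complex" and m :: nat
  assumes tw: "\<And>a c. a \<notin> \<int> \<Longrightarrow> c \<notin> \<int> \<Longrightarrow> F a (c + 1) = cis (- 2 * pi * a) * F a c"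
    and hecke: "\<And>a c. a \<notin> \<int> \<Longrightarrow> of_nat m * c \<notin> \<int> \<Longrightarrow>
           1 / of_nat m * (\<Sum>k<m. F ((a + of_nat k) / of_nat m) (of_nat m * c))
             = of_nat m powr (- s) * F a c"
    and m: "m \<ge> 1" and a: "a \<notin> \<int>" and c: "of_nat m * c \<notin> \<int>"
  defines "F' \<equiv> \<lambda>a c. cis (- 2 * pi * a * c) * F c (- a)"
  shows "1 / of_nat m * (\<Sum>k<m. F' ((a + of_nat k) / of_nat m) (of_nat m * c))
           = of_nat m powr (- (1 - s)) * F' a c"
proof -
  let ?F' = "\<lambda>k. F' ((a + real k) / real m) (real m * c)"
  \<comment> \<open>The Hecke relation is used at the point \<open>(m * c, - (a + k) / m)\<close>.
    Undoing the shift by \<open>- k\<close> gives the phase \<open>k * (c + j / m)\<close>, whose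
    \<open>k * c\<close> part cancels against the prefactor of \<open>F'\<close>.\<close>
  have eq: "of_nat m powr (- s) * ?F' k
      = 1 / of_nat m * (\<Sum>j<m. cis (- 2 * pi * a * c) * F (c + real j / real m) (- a) * cis (2 * pi * real k * (real j / real m)))"
    for k
  proof -
    have ak: "- (a + real k) \<notin> \<int>" "- a \<notin> \<int>" using a by (auto simp: minus_in_Ints_iff simp flip: minus_add_distrib)
    have mm: "real m * (- (a + real k) / real m) = - (a + real k)" using m by simp
    have "F ((real m * c + real j) / real m) (- (a + real k)) = cis (2 * pi * real k * (c + real j / real m)) * F (c + real j / real m) (- a)"
      for j
    proof -
      have e: "(real m * c + real j) / real m = c + real j / real m" using m by (simp add: field_simps)
      have "c + real j / real m \<notin> \<int>"
      proof
        assume "c + real j / real m \<in> \<int>"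
        then have "real m * (c + real j / real m) - real j \<in> \<int>" by (intro Ints_diff Ints_mult) auto
        moreover have "real m * (c + real j / real m) - real j = real m * c" using m by (simp add: field_simps)
        ultimately show False using c by simp
      qed
      from twisted_periodic_int[of F, OF tw this ak(2), of "- int k"]
      show ?thesis unfolding e by (simp add: mult_ac)
    qed
    then have eq1: "of_nat m powr (- s) * F (real m * c) (- (a + real k) / real m)
       = 1 / of_nat m * (\<Sum>j<m. cis (2 * pi * real k * (c + real j / real m)) * F (c + real j / real m) (- a))"
      using hecke[of "real m * c" "- (a + real k) / real m", unfolded mm, OF c ak(1)] by simp
    have eq2: "?F' k = cis (- 2 * pi * (a + real k) * c) * F (real m * c) (- (a + real k) / real m)"
    proof -
      have "- 2 * pi * ((a + real k) / real m) * (real m * c) = - 2 * pi * (a + real k) * c"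
        using m by simp
      moreover have "- ((a + real k) / real m) = - (a + real k) / real m"
        by (rule minus_divide_left)
      ultimately show ?thesis unfolding F'_def by (simp only:)
    qed
    have "of_nat m powr (- s) * ?F' k
       = 1 / of_nat m * (cis (- 2 * pi * (a + real k) * c) * (\<Sum>j<m. cis (2 * pi * real k * (c + real j / real m)) * F (c + real j / real m) (- a)))"
      unfolding eq2 mult.left_commute[of "of_nat m powr (- s)"] eq1 by (rule mult.left_commute)
    also have "cis (- 2 * pi * (a + real k) * c) * (\<Sum>j<m. cis (2 * pi * real k * (c + real j / real m)) * F (c + real j / real m) (- a))
       = (\<Sum>j<m. cis (- 2 * pi * a * c) * F (c + real j / real m) (- a) * cis (2 * pi * real k * (real j / real m)))"
      unfolding sum_distrib_left
    proof (rule sum.cong[OF refl])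
      fix j
      have "cis (- 2 * pi * (a + real k) * c) * (cis (2 * pi * real k * (c + real j / real m)) * F (c + real j / real m) (- a))
         = cis (- 2 * pi * (a + real k) * c + 2 * pi * real k * (c + real j / real m)) * F (c + real j / real m) (- a)"
        by (rule cis_mult_left)
      also have "- 2 * pi * (a + real k) * c + 2 * pi * real k * (c + real j / real m)
         = - 2 * pi * a * c + 2 * pi * real k * (real j / real m)" by (simp add: algebra_simps)
      finally show "cis (- 2 * pi * (a + real k) * c) * (cis (2 * pi * real k * (c + real j / real m)) * F (c + real j / real m) (- a))
         = cis (- 2 * pi * a * c) * F (c + real j / real m) (- a) * cis (2 * pi * real k * (real j / real m))"
        by (simp only: cis_mult[symmetric] mult_ac)
    qed
    finally show ?thesis .
  qed
  have "of_nat m powr (- s) * (\<Sum>k<m. ?F' k)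
      = 1 / of_nat m * (\<Sum>k<m. \<Sum>j<m. cis (- 2 * pi * a * c) * F (c + real j / real m) (- a) * cis (2 * pi * real k * (real j / real m)))"
    unfolding sum_distrib_left eq ..
  also have "(\<Sum>k<m. \<Sum>j<m. cis (- 2 * pi * a * c) * F (c + real j / real m) (- a) * cis (2 * pi * real k * (real j / real m)))
      = (\<Sum>j<m. cis (- 2 * pi * a * c) * F (c + real j / real m) (- a) * (if j = 0 then of_nat m else 0))"
    by (subst sum.swap, unfold sum_distrib_left[symmetric]) (intro sum.cong refl arg_cong2[where f = times] sum_roots_of_unity, simp)
  also have "\<dots> = (\<Sum>j<m. if j = 0 then of_nat m * F' a c else 0)"
    by (intro sum.cong) (auto simp: F'_def)
  also have "\<dots> = of_nat m * F' a c" using m by simp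
  finally have *: "of_nat m powr (- s) * (\<Sum>k<m. ?F' k) = F' a c" using m by simp
  have "of_nat m powr (- (1 - s)) = of_nat m powr s / (of_nat m :: complex)"
    using m by (simp add: powr_diff)
  moreover have "of_nat m powr s * of_nat m powr (- s) = (1::complex)"
    using m by (simp add: powr_minus)
  ultimately have "of_nat m powr (- (1 - s)) * F' a c = 1 / of_nat m * (\<Sum>k<m. ?F' k)"
    unfolding *[symmetric] by (simp flip: mult.assoc)
  then show ?thesis by simp
qed

section \<open>Assembling the two cases\<close>

lemma module_pointwise: "module (\<lambda>(k::complex) (G :: real \<times> real \<Rightarrow> complex) p. k * G p)"
  by unfold_locales (auto simp: fun_eq_iff algebra_simps)

lemma lerch_space_combination:
  fixes G H :: "real \<times> real \<Rightarrow> complex" and s :: complex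
  defines "S \<equiv> {\<lambda>(a, c). Lplus s a c, \<lambda>(a, c). Lminus s a c,
        \<lambda>(a, c). cis (- 2 * pi * a * c) * Lplus (1 - s) (1 - c) a,
        \<lambda>(a, c). cis (- 2 * pi * a * c) * Lminus (1 - s) (1 - c) a}"
  assumes "G \<in> S" and "H \<in> S"
  shows "(\<lambda>p. A * G p + B * H p) \<in> lerch_space s"
proof -
  interpret module "\<lambda>(k::complex) (G :: real \<times> real \<Rightarrow> complex) p. k * G p"
    by (rule module_pointwise)
  have "(\<lambda>p. A * G p) + (\<lambda>p. B * H p) \<in> span S"
    using assms by (intro span_add span_scale span_base)
  then show ?thesis by (simp add: lerch_space_def S_def plus_fun_def)
qed

theorem theorem2p4:
  fixes s :: complex and F :: "real \<times> real \<Rightarrow> complex"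
  assumes cont: "continuous_on ((- \<int>) \<times> (- \<int>)) F"
    and periodic_a: "\<And>a c. a \<notin> \<int> \<Longrightarrow> c \<notin> \<int> \<Longrightarrow> F (a + 1, c) = F (a, c)"
    and twisted_c: "\<And>a c. a \<notin> \<int> \<Longrightarrow> c \<notin> \<int> \<Longrightarrow>
           F (a, c + 1) = cis (- 2 * pi * a) * F (a, c)"
    and integrability:
      "(Re s > 0 \<and>
        (\<forall>c\<in>{0<..<1}. set_integrable lborel {0<..<1} (\<lambda>a. F (a, c))) \<and>
        (\<forall>n::int. continuous_on {0<..<1}
           (\<lambda>c. LBINT a:{0<..<1}. F (a, c) * cis (- 2 * pi * of_int n * a))))
       \<or>
       (Re s < 1 \<and>
        (\<forall>a\<in>{0<..<1}. set_integrable lborel {0<..<1} (\<lambda>c. cis (2 * pi * a * c) * F (a, c))) \<and>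
        (\<forall>n::int. continuous_on {0<..<1}
           (\<lambda>a. LBINT c:{0<..<1}.
              cis (2 * pi * a * c) * F (a, c) * cis (- 2 * pi * of_int n * c))))"
    and hecke: "\<And>(m::nat) a c. m \<ge> 1 \<Longrightarrow> a \<notin> \<int> \<Longrightarrow> of_nat m * c \<notin> \<int> \<Longrightarrow>
           1 / of_nat m * (\<Sum>k<m. F ((a + of_nat k) / of_nat m, of_nat m * c))
             = of_nat m powr (- s) * F (a, c)"
  shows "\<exists>G\<in>lerch_space s. \<forall>a c. a \<notin> \<int> \<longrightarrow> c \<notin> \<int> \<longrightarrow> F (a, c) = G (a, c)"
  using integrability
proof (elim disjE conjE)
  assume s: "Re s > 0"
    and int: "\<forall>c\<in>{0<..<1}. set_integrable lborel {0<..<1} (\<lambda>a. F (a, c))"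
    and coeff: "\<forall>n::int. continuous_on {0<..<1}
           (\<lambda>c. LBINT a:{0<..<1}. F (a, c) * cis (- 2 * pi * of_int n * a))"
  have "continuous_on (- \<int>) (\<lambda>a. F (a, c))" if "c \<notin> \<int>" for c
    by (rule continuous_on_compose2[OF cont]) (use that in \<open>auto intro!: continuous_intros\<close>)
  then obtain A B where AB: "\<And>a c. a \<notin> \<int> \<Longrightarrow> c \<notin> \<int> \<Longrightarrow> F (a, c) = A * Lplus s a c + B * Lminus s a c"
    by (rule hecke_eigenfunction_fourier_a[OF s, of "\<lambda>a c. F (a, c)"])
      (use int coeff periodic_a twisted_c hecke in
        \<open>auto simp: set_integrable_unit_iff set_integral_unit_eq\<close>)
  show ?thesis
    using lerch_space_combination[of "\<lambda>(a, c). Lplus s a c" s "\<lambda>(a, c). Lminus s a c" A B] AB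
    by (intro bexI[of _ "\<lambda>p. A * (case p of (a, c) \<Rightarrow> Lplus s a c) + B * (case p of (a, c) \<Rightarrow> Lminus s a c)"]) auto
next
  assume s: "Re s < 1"
    and int: "\<forall>a\<in>{0<..<1}. set_integrable lborel {0<..<1} (\<lambda>c. cis (2 * pi * a * c) * F (a, c))"
    and coeff: "\<forall>n::int. continuous_on {0<..<1}
           (\<lambda>a. LBINT c:{0<..<1}.
              cis (2 * pi * a * c) * F (a, c) * cis (- 2 * pi * of_int n * c))"
  \<comment> \<open>The exponential factor exchanges the two kinds of periodicity: it cancels the
    twist of \<open>F\<close> in its second variable, making \<open>F'\<close> periodic in
    \<open>a\<close>, and turns the plain period of \<open>F\<close> into a twist in
    \<open>c\<close>.\<close>
  define F' where "F' = (\<lambda>a c. cis (- 2 * pi * a * c) * F (c, - a))"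
  have unit: "t \<notin> \<int>" if "t \<in> {0<..<1}" for t :: real
    using that by (auto elim!: Ints_cases)
  have neg: "- t \<notin> \<int>" if "t \<notin> \<int>" for t :: real
    using that by (simp add: minus_in_Ints_iff)
  \<comment> \<open>For \<open>a\<close> in the unit interval so is \<open>1 - a\<close>, and the
    prefactor becomes the one in the hypotheses of this case.\<close>
  have reflect: "F' a c = cis (2 * pi * c * (1 - a)) * F (c, 1 - a)" if "a \<notin> \<int>" "c \<notin> \<int>" for a c
  proof -
    have eq: "F (c, 1 - a) = cis (- 2 * pi * c) * F (c, - a)"
      using twisted_c[of c "- a"] neg that by simp
    show ?thesis unfolding F'_def eq cis_mult_left by (simp add: algebra_simps)
  qed
  have "\<exists>A B. \<forall>a c. a \<notin> \<int> \<longrightarrow> c \<notin> \<int> \<longrightarrow> F' a c = A * Lplus (1 - s) a c + B * Lminus (1 - s) a c"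
  proof (rule hecke_eigenfunction_fourier_a[of "1 - s" F'])
    show "Re (1 - s) > 0" using s by simp
    show "continuous_on (- \<int>) (\<lambda>a. F' a c)" if "c \<notin> \<int>" for c
      unfolding F'_def
      by (intro continuous_intros continuous_on_compose2[OF cont]) (use that in \<open>auto simp: minus_in_Ints_iff\<close>)
    show "F' (a + 1) c = F' a c" if "a \<notin> \<int>" "c \<notin> \<int>" for a c
    proof -
      have eq: "F (c, - a) = cis (- 2 * pi * c) * F (c, - (a + 1))"
        using twisted_c[of c "- (a + 1)"] neg[of "a + 1"] that by simp
      show ?thesis unfolding F'_def eq cis_mult_left by (simp add: algebra_simps)
    qed
    show "F' a (c + 1) = cis (- 2 * pi * a) * F' a c" if "a \<notin> \<int>" "c \<notin> \<int>" for a c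
    proof -
      have eq: "F (c + 1, - a) = F (c, - a)"
        using periodic_a[of c "- a"] neg that by simp
      show ?thesis unfolding F'_def eq cis_mult_left by (simp add: algebra_simps)
    qed
    show "integrable unit_lborel (\<lambda>a. F' a c)" if c: "c \<in> {0<..<1}" for c
    proof -
      have "integrable unit_lborel (\<lambda>a. cis (2 * pi * c * (1 - a)) * F (c, 1 - a))"
        using int c unit_reflect(1)[of "\<lambda>t. cis (2 * pi * c * t) * F (c, t)"]
        by (simp add: set_integrable_unit_iff)
      then show ?thesis
        using reflect unit c by (subst Bochner_Integration.integrable_cong[OF refl]) auto
    qed
    show "continuous_on {0<..<1} (\<lambda>c. \<integral>a. F' a c * cis (- 2 * pi * of_int n * a) \<partial>unit_lborel)" for n :: int
    \<comment> \<open>The reflection reverses frequencies, so the \<open>n\<close>-th coefficient of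
      \<open>F'\<close> is the \<open>- n\<close>-th coefficient in the hypothesis.\<close>
    proof (rule continuous_on_eq[OF coeff[rule_format, of "- n"]])
      fix c :: real assume c: "c \<in> {0<..<1}"
      have "(\<integral>a. F' a c * cis (- 2 * pi * of_int n * a) \<partial>unit_lborel)
          = (\<integral>a. cis (2 * pi * c * (1 - a)) * F (c, 1 - a) * cis (2 * pi * of_int n * (1 - a)) \<partial>unit_lborel)"
      proof (rule Bochner_Integration.integral_cong[OF refl])
        fix a assume "a \<in> space unit_lborel"
        moreover have "cis (2 * pi * of_int n * (1 - a)) = cis (2 * pi * of_int n) * cis (- 2 * pi * of_int n * a)"
          by (simp only: cis_mult) (simp add: algebra_simps)
        moreover have "cis (2 * pi * of_int n) = 1" by (subst cis_2pi_eq_1_iff) auto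
        ultimately show "F' a c * cis (- 2 * pi * of_int n * a)
            = cis (2 * pi * c * (1 - a)) * F (c, 1 - a) * cis (2 * pi * of_int n * (1 - a))"
          using reflect[OF unit unit[OF c], of a] by simp
      qed
      also have "\<dots> = (\<integral>t. cis (2 * pi * c * t) * F (c, t) * cis (2 * pi * of_int n * t) \<partial>unit_lborel)"
        by (rule unit_reflect(2))
      finally show "(LBINT t:{0<..<1}. cis (2 * pi * c * t) * F (c, t) * cis (- 2 * pi * of_int (- n) * t))
          = (\<integral>a. F' a c * cis (- 2 * pi * of_int n * a) \<partial>unit_lborel)"
        by (simp add: set_integral_unit_eq)
    qed
    show "1 / of_nat m * (\<Sum>k<m. F' ((a + of_nat k) / of_nat m) (of_nat m * c)) = of_nat m powr (- (1 - s)) * F' a c"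
      if "m \<ge> 1" "a \<notin> \<int>" "of_nat m * c \<notin> \<int>" for m a c
      unfolding F'_def
      by (rule hecke_reflect[of "\<lambda>a c. F (a, c)", OF twisted_c hecke[OF that(1)] that])
  qed blast
  then obtain A B where AB: "\<And>a c. a \<notin> \<int> \<Longrightarrow> c \<notin> \<int> \<Longrightarrow> F' a c = A * Lplus (1 - s) a c + B * Lminus (1 - s) a c"
    by blast
  have "F (a, c) = A * (cis (- 2 * pi * a * c) * Lplus (1 - s) (1 - c) a) + B * (cis (- 2 * pi * a * c) * Lminus (1 - s) (1 - c) a)"
    if a: "a \<notin> \<int>" and c: "c \<notin> \<int>" for a c
  proof -
    have "1 - c \<notin> \<int>" "c - 1 \<notin> \<int>" using c Ints_diff[of 1 "1 - c"] Ints_add[of "c - 1" 1] by auto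
    \<comment> \<open>The exchange is inverted at \<open>(1 - c, a)\<close>, where \<open>F'\<close>
      involves \<open>F (a, c - 1)\<close>; this produces the argument \<open>1 - c\<close> of the
      last two generators.\<close>
    have "F (a, c) = cis (- 2 * pi * a) * F (a, c - 1)"
      using twisted_c[OF a \<open>c - 1 \<notin> \<int>\<close>] by simp
    also have "\<dots> = cis (- 2 * pi * a * c) * F' (1 - c) a"
      unfolding F'_def cis_mult_left by (simp add: algebra_simps)
    also have "F' (1 - c) a = A * Lplus (1 - s) (1 - c) a + B * Lminus (1 - s) (1 - c) a"
      using \<open>1 - c \<notin> \<int>\<close> a by (rule AB)
    finally show ?thesis by (simp add: algebra_simps)
  qed
  then show ?thesis
    using lerch_space_combination[of "\<lambda>(a, c). cis (- 2 * pi * a * c) * Lplus (1 - s) (1 - c) a" s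
        "\<lambda>(a, c). cis (- 2 * pi * a * c) * Lminus (1 - s) (1 - c) a" A B]
    by (intro bexI[of _ "\<lambda>p. A * (case p of (a, c) \<Rightarrow> cis (- 2 * pi * a * c) * Lplus (1 - s) (1 - c) a)
        + B * (case p of (a, c) \<Rightarrow> cis (- 2 * pi * a * c) * Lminus (1 - s) (1 - c) a)"]) auto
qed

end
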